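(* Let $n \in \mathbb{Z}$ with $n \neq \pm 1$, and let $BS(1,n) = \langle a, t \mid a = t^{-1}a^n t\rangle$. Then the endo-twisted conjugacy problem is solvable in $BS(1,n)$: there is an algorithm which, given an endomorphism $\psi \colon BS(1,n) \to BS(1,n)$ (specified by words in $a^{\pm1}, t^{\pm1}$ representing the images $a\psi$ and $t\psi$ of the generators) and two words $u, v$ in $a^{\pm 1}, t^{\pm 1}$, decides whether there exists $x \in BS(1,n)$ such that $v = (x\psi)^{-1}\, u\, x$ in $BS(1,n)$.
   Context: Homomorphisms are written with the argument on the left: $x\psi$ denotes the image of $x$ under $\psi$. For a group $G$, $\psi \in \operatorname{End}(G)$ and $u,v \in G$, the elements $u$ and $v$ are called $\psi$-twisted conjugated, written $u \sim_\psi v$, if there exists $x \in G$ with $v = (x\psi)^{-1} u x$. The endo-twisted conjugacy problem for a finitely presented group $G = \langle X \mid R\rangle$ asks to decide, given $\psi \in \operatorname{End}(G)$ (by the images of the generators) and two words $u, v$ on the generators, whether $u \sim_\psi v$ in $G$. *)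

theory Defs
  imports "HOL-Algebra.Group" "HOL-Library.Nat_Bijection"
begin

section \<open>Groups given by generators and relations\<close>

text \<open>The letter \<open>(x, True)\<close> stands for the generator \<open>x\<close>, and \<open>(x, False)\<close> for its inverse.\<close>

type_synonym 'x word = "('x \<times> bool) list"

definition words :: "'x set \<Rightarrow> 'x word set" where
  "words X = lists (X \<times> UNIV)"

definition gen_power :: "'x \<Rightarrow> int \<Rightarrow> 'x word" where
  "gen_power x k = replicate (nat \<bar>k\<bar>) (x, 0 \<le> k)"

text \<open>A pair \<open>(l, r) \<in> R\<close> is the defining relation \<open>l = r\<close>.\<close>

inductive pres_eq :: "'x set \<Rightarrow> ('x word \<times> 'x word) set \<Rightarrow> 'x word \<Rightarrow> 'x word \<Rightarrow> bool"
  for X :: "'x set" and R :: "('x word \<times> 'x word) set" where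
  refl: "u \<in> words X \<Longrightarrow> pres_eq X R u u"
| sym: "pres_eq X R u v \<Longrightarrow> pres_eq X R v u"
| trans: "pres_eq X R u v \<Longrightarrow> pres_eq X R v w \<Longrightarrow> pres_eq X R u w"
| cancel: "u \<in> words X \<Longrightarrow> v \<in> words X \<Longrightarrow> x \<in> X \<Longrightarrow>
    pres_eq X R (u @ [(x, b), (x, \<not> b)] @ v) (u @ v)"
| relation: "u \<in> words X \<Longrightarrow> v \<in> words X \<Longrightarrow> (l, r) \<in> R \<Longrightarrow>
    pres_eq X R (u @ l @ v) (u @ r @ v)"

definition word_class :: "'x set \<Rightarrow> ('x word \<times> 'x word) set \<Rightarrow> 'x word \<Rightarrow> 'x word set" where
  "word_class X R u = {v. pres_eq X R u v}"

text \<open>The group \<open>\<langle>X | R\<rangle>\<close>, for \<open>R \<subseteq> words X \<times> words X\<close>.\<close>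

definition presented_group ::
    "'x set \<Rightarrow> ('x word \<times> 'x word) set \<Rightarrow> 'x word set monoid" where
  "presented_group X R =
    \<lparr>carrier = word_class X R ` words X,
     mult = (\<lambda>A B. \<Union>u\<in>A. \<Union>v\<in>B. word_class X R (u @ v)),
     one = word_class X R []\<rparr>"

lemma words_append [simp]: "u @ v \<in> words X \<longleftrightarrow> u \<in> words X \<and> v \<in> words X"
  by (auto simp: words_def)

lemma words_Nil [simp]: "[] \<in> words X"
  by (simp add: words_def)

lemma words_Cons [simp]: "l # u \<in> words X \<longleftrightarrow> fst l \<in> X \<and> u \<in> words X"
  by (cases l) (auto simp: words_def)

lemma pres_eq_words:
  assumes "pres_eq X R u v" "R \<subseteq> words X \<times> words X"
  shows "u \<in> words X \<and> v \<in> words X"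
  using assms by (induction rule: pres_eq.induct) auto

lemma pres_eq_context:
  assumes "pres_eq X R u v" "p \<in> words X" "q \<in> words X"
  shows "pres_eq X R (p @ u @ q) (p @ v @ q)"
  using assms(1)
proof (induction rule: pres_eq.induct)
  case (refl u)
  then show ?case using assms(2,3) by (intro pres_eq.refl) simp
next
  case (sym u v)
  then show ?case by (rule_tac pres_eq.sym)
next
  case (trans u v w)
  then show ?case by (blast intro: pres_eq.trans)
next
  case (cancel u v x b)
  then show ?case using assms(2,3) pres_eq.cancel[of "p @ u" X "v @ q" x R b] by simp
next
  case (relation u v l r)
  then show ?case using assms(2,3) pres_eq.relation[of "p @ u" X "v @ q" l r R] by simp
qed

lemma pres_eq_append:
  assumes "pres_eq X R u u'" "pres_eq X R v v'" "R \<subseteq> words X \<times> words X"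
  shows "pres_eq X R (u @ v) (u' @ v')"
proof -
  have "pres_eq X R (u @ v) (u' @ v)"
    using pres_eq_context[OF assms(1), of "[]" v] pres_eq_words[OF assms(2,3)] by simp
  moreover have "pres_eq X R (u' @ v) (u' @ v')"
    using pres_eq_context[OF assms(2), of u' "[]"] pres_eq_words[OF assms(1,3)] by simp
  ultimately show ?thesis by (rule pres_eq.trans)
qed

lemma word_class_eq_iff:
  assumes "u \<in> words X"
  shows "word_class X R u = word_class X R v \<longleftrightarrow> pres_eq X R u v"
proof
  assume "word_class X R u = word_class X R v"
  moreover have "u \<in> word_class X R u"
    using assms by (simp add: word_class_def pres_eq.refl)
  ultimately have "pres_eq X R v u" by (simp add: word_class_def)
  then show "pres_eq X R u v" by (rule pres_eq.sym)
next
  assume *: "pres_eq X R u v"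
  then have "pres_eq X R u w \<longleftrightarrow> pres_eq X R v w" for w
    using pres_eq.trans[OF *, of w] pres_eq.trans[OF pres_eq.sym[OF *], of w] by blast
  then show "word_class X R u = word_class X R v" by (simp add: word_class_def)
qed

lemma mult_word_class:
  assumes "R \<subseteq> words X \<times> words X" "u \<in> words X" "v \<in> words X"
  shows "word_class X R u \<otimes>\<^bsub>presented_group X R\<^esub> word_class X R v = word_class X R (u @ v)"
proof -
  have eq: "word_class X R (u' @ v') = word_class X R (u @ v)"
    if "pres_eq X R u u'" "pres_eq X R v v'" for u' v'
    using pres_eq_append[OF that assms(1)] assms(2,3) word_class_eq_iff[of "u @ v" X R "u' @ v'"]
    by simp
  have "u \<in> word_class X R u" "v \<in> word_class X R v"
    using assms(2,3) by (auto simp: word_class_def intro: pres_eq.refl)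
  moreover have "word_class X R (u' @ v') = word_class X R (u @ v)"
    if "u' \<in> word_class X R u" "v' \<in> word_class X R v" for u' v'
    using that eq by (simp add: word_class_def[of X R u] word_class_def[of X R v])
  ultimately have "(\<Union>u'\<in>word_class X R u. \<Union>v'\<in>word_class X R v. word_class X R (u' @ v')) =
      word_class X R (u @ v)"
    by blast
  then show ?thesis by (simp add: presented_group_def)
qed

lemma left_inverse_word:
  assumes "u \<in> words X" "R \<subseteq> words X \<times> words X"
  shows "\<exists>v\<in>words X. pres_eq X R (v @ u) []"
  using assms(1)
proof (induction u)
  case Nil
  then show ?case by (intro bexI[of _ "[]"]) (auto intro: pres_eq.refl)
next
  case (Cons l u)
  obtain x b where l: "l = (x, b)" by (cases l)
  have x: "x \<in> X" and u: "u \<in> words X" using Cons.prems by (auto simp: l)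
  obtain v where v: "v \<in> words X" "pres_eq X R (v @ u) []" using Cons.IH u by auto
  have "pres_eq X R ((v @ [(x, \<not> b)]) @ l # u) (v @ u)"
    using pres_eq.cancel[of v X u x R "\<not> b"] v(1) u x by (simp add: l)
  then have "pres_eq X R ((v @ [(x, \<not> b)]) @ l # u) []" using v(2) by (rule pres_eq.trans)
  moreover have "v @ [(x, \<not> b)] \<in> words X" using v(1) x by simp
  ultimately show ?case by blast
qed

lemma group_presented_group:
  assumes R: "R \<subseteq> words X \<times> words X"
  shows "group (presented_group X R)" (is "group ?G")
proof (rule groupI)
  have car: "carrier ?G = word_class X R ` words X"
    and one: "\<one>\<^bsub>?G\<^esub> = word_class X R []"
    by (simp_all add: presented_group_def)
  note mult = mult_word_class[OF R]
  show "\<one>\<^bsub>?G\<^esub> \<in> carrier ?G" by (simp add: car one)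
  show "A \<otimes>\<^bsub>?G\<^esub> B \<in> carrier ?G" if "A \<in> carrier ?G" "B \<in> carrier ?G" for A B
    using that by (auto simp: car mult)
  show "A \<otimes>\<^bsub>?G\<^esub> B \<otimes>\<^bsub>?G\<^esub> C = A \<otimes>\<^bsub>?G\<^esub> (B \<otimes>\<^bsub>?G\<^esub> C)"
    if "A \<in> carrier ?G" "B \<in> carrier ?G" "C \<in> carrier ?G" for A B C
    using that by (auto simp: car mult)
  fix A assume "A \<in> carrier ?G"
  then obtain u where u: "u \<in> words X" "A = word_class X R u" by (auto simp: car)
  show "\<one>\<^bsub>?G\<^esub> \<otimes>\<^bsub>?G\<^esub> A = A" by (simp add: u one mult)
  obtain v where v: "v \<in> words X" "pres_eq X R (v @ u) []"
    using left_inverse_word[OF u(1) R] by blast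
  have "word_class X R v \<otimes>\<^bsub>?G\<^esub> A = \<one>\<^bsub>?G\<^esub>"
    using u v word_class_eq_iff[of "v @ u" X R "[]"] by (simp add: one mult)
  moreover have "word_class X R v \<in> carrier ?G" using v(1) by (simp add: car)
  ultimately show "\<exists>B\<in>carrier ?G. B \<otimes>\<^bsub>?G\<^esub> A = \<one>\<^bsub>?G\<^esub>" by blast
qed

section \<open>Partial recursive functions\<close>

text \<open>\<open>computes f xs y\<close> means that the partial function defined by \<open>f\<close> is defined at the argument
  tuple \<open>xs\<close> and takes the value \<open>y\<close> there. Recursion and minimisation use the first argument.\<close>

datatype recf =
    Zero
  | Succ
  | Proj nat
  | Comp recf "recf list"
  | Prec recf recf
  | Minim recf

inductive computes :: "recf \<Rightarrow> nat list \<Rightarrow> nat \<Rightarrow> bool" where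
  Zero: "computes Zero xs 0"
| Succ: "computes Succ [x] (Suc x)"
| Proj: "i < length xs \<Longrightarrow> computes (Proj i) xs (xs ! i)"
| Comp: "list_all2 (\<lambda>g y. computes g xs y) gs ys \<Longrightarrow> computes f ys z \<Longrightarrow>
    computes (Comp f gs) xs z"
| Prec_0: "computes f xs z \<Longrightarrow> computes (Prec f g) (0 # xs) z"
| Prec_Suc: "computes (Prec f g) (m # xs) y \<Longrightarrow> computes g (m # y # xs) z \<Longrightarrow>
    computes (Prec f g) (Suc m # xs) z"
| Minim: "computes f (m # xs) 0 \<Longrightarrow> (\<And>i. i < m \<Longrightarrow> \<exists>y. computes f (i # xs) (Suc y)) \<Longrightarrow>
    computes (Minim f) xs m"

inductive_cases computes_ZeroE: "computes Zero xs y"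
inductive_cases computes_SuccE: "computes Succ xs y"
inductive_cases computes_ProjE: "computes (Proj i) xs y"
inductive_cases computes_CompE: "computes (Comp f gs) xs y"
inductive_cases computes_Prec_0E: "computes (Prec f g) (0 # xs) y"
inductive_cases computes_Prec_SucE: "computes (Prec f g) (Suc m # xs) y"
inductive_cases computes_MinimE: "computes (Minim f) xs y"

lemma computes_deterministic:
  assumes "computes f xs y" "computes f xs y'"
  shows "y = y'"
  using assms
proof (induction arbitrary: y' rule: computes.induct)
  case (Zero xs)
  then show ?case by (blast elim: computes_ZeroE)
next
  case (Succ x)
  then show ?case by (blast elim: computes_SuccE)
next
  case (Proj i xs)
  then show ?case by (blast elim: computes_ProjE)
next
  case (Comp xs gs ys f z)
  from Comp.prems obtain ys' where
    ys': "list_all2 (\<lambda>g y. computes g xs y) gs ys'" "computes f ys' y'"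
    by (rule computes_CompE)
  have "length ys = length ys'"
    using list_all2_lengthD[OF Comp.IH(1)] list_all2_lengthD[OF ys'(1)] by simp
  moreover have "ys ! i = ys' ! i" if "i < length ys" for i
    using that Comp.IH(1) ys'(1) unfolding list_all2_conv_all_nth by metis
  ultimately have "ys = ys'" by (rule nth_equalityI)
  then show ?case using Comp.IH(2) ys'(2) by blast
next
  case (Prec_0 f xs z g)
  then show ?case by (blast elim: computes_Prec_0E)
next
  case (Prec_Suc f g m xs y z)
  from Prec_Suc.prems obtain w where
    "computes (Prec f g) (m # xs) w" "computes g (m # w # xs) y'"
    by (rule computes_Prec_SucE)
  then show ?case using Prec_Suc.IH by blast
next
  case (Minim f m xs)
  from Minim.prems have zero: "computes f (y' # xs) 0"
    by (rule computes_MinimE)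
  from Minim.prems have pos: "\<exists>y. computes f (i # xs) (Suc y)" if "i < y'" for i
    by (rule computes_MinimE) (use that in blast)
  show ?case
  proof (rule linorder_cases[of m y'])
    assume "m < y'"
    then show ?thesis using pos[of m] Minim.IH(1) by blast
  next
    assume "y' < m"
    then show ?thesis using zero Minim.IH(2)[of y'] by blast
  qed
qed

section \<open>The endo-twisted conjugacy problem\<close>

definition twisted_conjugated ::
    "('g, 'r) monoid_scheme \<Rightarrow> ('g \<Rightarrow> 'g) \<Rightarrow> 'g \<Rightarrow> 'g \<Rightarrow> bool" where
  "twisted_conjugated G \<psi> u v \<longleftrightarrow>
    (\<exists>x\<in>carrier G. v = inv\<^bsub>G\<^esub> (\<psi> x) \<otimes>\<^bsub>G\<^esub> u \<otimes>\<^bsub>G\<^esub> x)"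

text \<open>For the purposes of computation the generators are the numbers below some \<open>k\<close>.\<close>

definition letter_code :: "nat \<times> bool \<Rightarrow> nat" where
  "letter_code = (\<lambda>(i, b). 2 * i + (if b then 0 else 1))"

definition word_code :: "nat word \<Rightarrow> nat" where
  "word_code w = list_encode (map letter_code w)"

text \<open>The algorithm receives the \<open>k + 2\<close> words \<open>ws ! 0, \<dots>, ws ! (k - 1), u, v\<close>, where \<open>ws ! i\<close>
  represents the image of the generator \<open>i\<close>. As usual for a problem whose instances contain an
  endomorphism, it has to halt with the correct answer only if the words \<open>ws\<close> do define one.\<close>

definition endo_twisted_conjugacy_solvable :: "nat \<Rightarrow> (nat word \<times> nat word) set \<Rightarrow> bool" where
  "endo_twisted_conjugacy_solvable k R \<longleftrightarrow>
    (let X = {..<k}; G = presented_group X R in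
     \<exists>f. \<forall>\<psi>\<in>hom G G. \<forall>ws u v.
       length ws = k \<longrightarrow> set ws \<subseteq> words X \<longrightarrow> u \<in> words X \<longrightarrow> v \<in> words X \<longrightarrow>
       (\<forall>i<k. \<psi> (word_class X R [(i, True)]) = word_class X R (ws ! i)) \<longrightarrow>
       computes f (map word_code (ws @ [u, v]))
         (if twisted_conjugated G \<psi> (word_class X R u) (word_class X R v) then 1 else 0))"

section \<open>The groups \<open>BS(1, n)\<close>\<close>

text \<open>\<open>a\<close> is the generator \<open>0\<close> and \<open>t\<close> the generator \<open>1\<close>; the relation is \<open>a = t\<inverse> a\<^sup>n t\<close>.\<close>

definition BS_relations :: "int \<Rightarrow> (nat word \<times> nat word) set" where
  "BS_relations n = (let a = 0; t = 1 in
     {(gen_power a 1, gen_power t (- 1) @ gen_power a n @ gen_power t 1)})"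

lemma BS_relations_words: "BS_relations n \<subseteq> words {..<2} \<times> words {..<2}"
  by (auto simp: BS_relations_def gen_power_def words_def)

end

theory Submission
  imports Defs Complex_Main
begin

text \<open>
  For \<open>\<bar>n\<bar> \<ge> 2\<close> the group embeds into the affine group of the rationals by \<open>a \<mapsto> (y \<mapsto> y + 1)\<close> and
  \<open>t \<mapsto> (y \<mapsto> n y)\<close>; an element becomes a pair \<open>(p, \<gamma>)\<close> with \<open>p\<close> an integer and \<open>\<gamma>\<close> in \<open>\<int>[1/n]\<close>.
  The relation forces \<open>a\<psi> = 1\<close> or \<open>t\<psi> = (1, \<beta>)\<close>. In the first case, which includes \<open>n = 0\<close>,
  \<open>u = (r, \<mu>)\<close> and \<open>v = (s, \<nu>)\<close> are twisted conjugated iff \<open>q - 1\<close> divides \<open>r - s\<close>, where \<open>q\<close> is the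
  exponent of \<open>t\<psi>\<close>. In the second case one needs \<open>r = s\<close> and a solution \<open>(p, \<gamma>)\<close> of
  \<open>D * \<gamma> = E - n\<^sup>p * F\<close>, which amounts to \<open>D\<close> dividing some \<open>n\<^sup>j * (n\<^sup>k * E - n\<^sup>i * F)\<close>
  after clearing denominators; since the powers of \<open>n\<close> are eventually periodic modulo \<open>D\<close>, bounded exponents suffice.
\<close>

section \<open>Total recursive functions\<close>

text \<open>Lists of other lengths are left unconstrained, so \<open>f\<close> can be written freely
  with \<open>!\<close>, \<open>drop\<close> and \<open>hd\<close>.\<close>

definition rec_fun :: "nat \<Rightarrow> (nat list \<Rightarrow> nat) \<Rightarrow> bool" where
  "rec_fun k f \<longleftrightarrow> (\<exists>r. \<forall>xs. length xs = k \<longrightarrow> computes r xs (f xs))"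

lemma rec_fun_cong:
  assumes "rec_fun k f" "\<And>xs. length xs = k \<Longrightarrow> f xs = g xs"
  shows "rec_fun k g"
  using assms by (auto simp: rec_fun_def)

lemma rec_fun_comp:
  assumes "rec_fun (length gs) f" "\<forall>g\<in>set gs. rec_fun k g"
  shows "rec_fun k (\<lambda>xs. f (map (\<lambda>g. g xs) gs))"
proof -
  obtain r where r: "\<And>ys. length ys = length gs \<Longrightarrow> computes r ys (f ys)"
    using assms(1) by (auto simp: rec_fun_def)
  obtain G where G: "\<And>g xs. g \<in> set gs \<Longrightarrow> length xs = k \<Longrightarrow> computes (G g) xs (g xs)"
    using assms(2) unfolding rec_fun_def by metis
  have "computes (Comp r (map G gs)) xs (f (map (\<lambda>g. g xs) gs))" if "length xs = k" for xs
  proof (rule computes.Comp)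
    show "list_all2 (\<lambda>r y. computes r xs y) (map G gs) (map (\<lambda>g. g xs) gs)"
      using that G by (auto simp: list_all2_conv_all_nth)
  qed (use r in simp)
  then show ?thesis unfolding rec_fun_def by blast
qed

lemma rec_fun_nth: "i < k \<Longrightarrow> rec_fun k (\<lambda>xs. xs ! i)"
  unfolding rec_fun_def by (intro exI[of _ "Proj i"]) (auto intro: computes.Proj)

text \<open>A bound variable of a sum or a quantifier is put in front of the argument list, and the
  older arguments are reached by \<open>drop\<close>. Up to three bound variables are nested
  later.\<close>

lemma rec_fun_nth_drop: "m + i < k \<Longrightarrow> rec_fun k (\<lambda>xs. drop m xs ! i)"
  by (rule rec_fun_cong[OF rec_fun_nth[of "m + i"]]) auto

lemma rec_fun_nth_drop_drop: "m' + (m + i) < k \<Longrightarrow> rec_fun k (\<lambda>xs. drop m (drop m' xs) ! i)"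
  by (rule rec_fun_cong[OF rec_fun_nth[of "m' + (m + i)"]]) (auto simp: ac_simps)

lemma rec_fun_nth_drop_drop_drop:
  "m'' + (m' + (m + i)) < k \<Longrightarrow> rec_fun k (\<lambda>xs. drop m (drop m' (drop m'' xs)) ! i)"
  by (rule rec_fun_cong[OF rec_fun_nth[of "m'' + (m' + (m + i))"]]) (auto simp: ac_simps)

lemma rec_fun_drop:
  assumes "rec_fun k f"
  shows "rec_fun (m + k) (\<lambda>xs. f (drop m xs))"
proof (rule rec_fun_cong)
  let ?gs = "map (\<lambda>i xs. xs ! (m + i)) [0..<k] :: (nat list \<Rightarrow> nat) list"
  show "rec_fun (m + k) (\<lambda>xs. f (map (\<lambda>g. g xs) ?gs))"
    using assms by (intro rec_fun_comp) (auto intro: rec_fun_nth)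
  show "f (map (\<lambda>g. g xs) ?gs) = f (drop m xs)" if "length xs = m + k" for xs
    using that by (intro arg_cong[of _ _ f] nth_equalityI) auto
qed

lemma rec_fun_comp1:
  assumes "rec_fun 1 (\<lambda>xs. F (xs ! 0))" "rec_fun k f"
  shows "rec_fun k (\<lambda>xs. F (f xs))"
  using rec_fun_comp[of "[f]" "\<lambda>xs. F (xs ! 0)" k] assms by simp

lemma rec_fun_comp2:
  assumes "rec_fun 2 (\<lambda>xs. F (xs ! 0) (xs ! 1))" "rec_fun k f" "rec_fun k g"
  shows "rec_fun k (\<lambda>xs. F (f xs) (g xs))"
  using rec_fun_comp[of "[f, g]" "\<lambda>xs. F (xs ! 0) (xs ! 1)" k] assms by (simp add: numeral_2_eq_2)

lemma rec_fun_Suc: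
  assumes "rec_fun k f"
  shows "rec_fun k (\<lambda>xs. Suc (f xs))"
proof (rule rec_fun_comp1[OF _ assms])
  have "computes Succ xs (Suc (xs ! 0))" if "length xs = 1" for xs
    using that computes.Succ[of "xs ! 0"] by (cases xs) auto
  then show "rec_fun 1 (\<lambda>xs. Suc (xs ! 0))" unfolding rec_fun_def by blast
qed

lemma rec_fun_const: "rec_fun k (\<lambda>_. c)"
proof (induction c)
  case 0
  then show ?case unfolding rec_fun_def by (blast intro: computes.Zero)
qed (rule rec_fun_Suc)

text \<open>\<open>Prec\<close> recurses on its first argument; composing with \<open>h\<close> and
  the projections puts \<open>h xs\<close> in front of \<open>xs\<close>.\<close>

lemma rec_fun_rec_nat:
  assumes f: "rec_fun k f" and h: "rec_fun k h"
    and g: "rec_fun (2 + k) (\<lambda>zs. g (zs ! 0) (zs ! 1) (drop 2 zs))"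
  shows "rec_fun k (\<lambda>xs. rec_nat (f xs) (\<lambda>m y. g m y xs) (h xs))"
proof -
  obtain rf where rf: "\<And>xs. length xs = k \<Longrightarrow> computes rf xs (f xs)"
    using f by (auto simp: rec_fun_def)
  obtain rg where rg: "\<And>xs. length xs = 2 + k \<Longrightarrow> computes rg xs (g (xs ! 0) (xs ! 1) (drop 2 xs))"
    using g unfolding rec_fun_def by blast
  have "computes (Prec rf rg) (m # xs) (rec_nat (f xs) (\<lambda>m y. g m y xs) m)"
    if "length xs = k" for m xs
  proof (induction m)
    case 0
    then show ?case using rf that by (simp add: computes.Prec_0)
  next
    case (Suc m)
    then show ?case using rg[of "m # _ # xs"] that by (auto intro!: computes.Prec_Suc)
  qed
  then have "computes (Prec rf rg) zs (rec_nat (f (tl zs)) (\<lambda>m y. g m y (tl zs)) (hd zs))"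
    if "length zs = Suc k" for zs
    using that by (cases zs) auto
  then have *: "rec_fun (Suc k) (\<lambda>zs. rec_nat (f (tl zs)) (\<lambda>m y. g m y (tl zs)) (hd zs))"
    unfolding rec_fun_def by blast
  let ?gs = "h # map (\<lambda>i xs. xs ! i) [0..<k]"
  have "map (\<lambda>g. g xs) ?gs = h xs # xs" if "length xs = k" for xs
    using that map_nth[of xs] by (simp add: comp_def)
  moreover have "rec_fun k (\<lambda>xs. (\<lambda>zs. rec_nat (f (tl zs)) (\<lambda>m y. g m y (tl zs)) (hd zs))
      (map (\<lambda>g. g xs) ?gs))"
    using * h by (intro rec_fun_comp) (auto intro: rec_fun_nth)
  ultimately show ?thesis
    by (elim rec_fun_cong) (metis list.sel(1,3))
qed

lemma rec_fun_add:
  assumes "rec_fun k f" "rec_fun k g"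
  shows "rec_fun k (\<lambda>xs. f xs + g xs)"
proof -
  have "rec_nat x (\<lambda>_. Suc) y = x + y" for x y :: nat
    by (induction y) auto
  then show ?thesis
    using rec_fun_rec_nat[OF assms, where g = "\<lambda>m y xs. Suc y"] by (simp add: rec_fun_Suc rec_fun_nth)
qed

lemma rec_fun_sum:
  assumes "rec_fun (Suc k) (\<lambda>zs. F (zs ! 0) (drop 1 zs))" "rec_fun k h"
  shows "rec_fun k (\<lambda>xs. \<Sum>i<h xs. F i xs)"
proof -
  have "rec_nat 0 (\<lambda>i y. y + F i xs) m = (\<Sum>i<m. F i xs)" for m xs
    by (induction m) auto
  moreover have "rec_fun (2 + k) (\<lambda>zs. F (zs ! 0) (drop 2 zs))"
  proof (rule rec_fun_cong)
    \<comment> \<open>Position 1 holds the partial sum, which the summand must not see.\<close>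
    let ?gs = "map (\<lambda>i xs. xs ! i) (0 # [2..<2 + k]) :: (nat list \<Rightarrow> nat) list"
    let ?F = "\<lambda>zs. F (zs ! 0) (drop 1 zs)"
    show "rec_fun (2 + k) (\<lambda>xs. ?F (map (\<lambda>g. g xs) ?gs))"
      using assms by (intro rec_fun_comp) (auto intro: rec_fun_nth simp: Suc_diff_le simp del: upt_Suc)
    show "?F (map (\<lambda>g. g xs) ?gs) = F (xs ! 0) (drop 2 xs)" if "length xs = 2 + k" for xs
    proof -
      have "map ((!) xs) [2..<2 + k] = drop 2 xs"
        using that by (intro nth_equalityI) (auto simp del: upt_Suc)
      then show ?thesis by (simp add: comp_def)
    qed
  qed
  ultimately show ?thesis
    using rec_fun_rec_nat[OF rec_fun_const[of k 0] assms(2), where g = "\<lambda>i y xs. y + F i xs"]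
    by (simp add: rec_fun_add rec_fun_nth)
qed

lemma rec_fun_mult:
  assumes "rec_fun k f" "rec_fun k g"
  shows "rec_fun k (\<lambda>xs. f xs * g xs)"
  using rec_fun_sum[of k "\<lambda>i. f" g] rec_fun_drop[OF assms(1), of 1] assms(2) by (simp add: mult.commute)

lemma rec_fun_pred:
  assumes "rec_fun k f"
  shows "rec_fun k (\<lambda>xs. f xs - 1)"
proof -
  have "rec_nat 0 (\<lambda>m _. m) x = x - 1" for x :: nat
    by (cases x) auto
  then show ?thesis
    using rec_fun_rec_nat[OF rec_fun_const[of k 0] assms, where g = "\<lambda>m _ _. m"] by (simp add: rec_fun_nth)
qed

lemma rec_fun_diff:
  assumes "rec_fun k f" "rec_fun k g"
  shows "rec_fun k (\<lambda>xs. f xs - g xs)"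
proof -
  have "rec_nat x (\<lambda>_ y. y - 1) y = x - y" for x y :: nat
    by (induction y) auto
  then show ?thesis
    using rec_fun_rec_nat[OF assms, where g = "\<lambda>m y xs. y - 1"] rec_fun_pred[OF rec_fun_nth[of 1 "2 + k"]]
    by simp
qed

lemma rec_fun_power:
  assumes "rec_fun k f"
  shows "rec_fun k (\<lambda>xs. c ^ f xs)"
proof -
  have "rec_nat 1 (\<lambda>_ y. y * c) m = c ^ m" for m
    by (induction m) auto
  then show ?thesis
    using rec_fun_rec_nat[OF rec_fun_const[of k 1] assms, where g = "\<lambda>m y xs. y * c"]
      rec_fun_mult[OF rec_fun_nth[of 1 "2 + k"] rec_fun_const[of _ c]]
    by simp
qed

section \<open>Decidable predicates\<close>

definition dec_pred :: "nat \<Rightarrow> (nat list \<Rightarrow> bool) \<Rightarrow> bool" where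
  "dec_pred k P \<longleftrightarrow> rec_fun k (\<lambda>xs. of_bool (P xs))"

lemma dec_pred_neq_0:
  assumes "rec_fun k f"
  shows "dec_pred k (\<lambda>xs. f xs \<noteq> 0)"
proof -
  have "rec_fun k (\<lambda>xs. 1 - (1 - f xs))"
    by (intro rec_fun_diff rec_fun_const assms)
  then show ?thesis unfolding dec_pred_def by (rule rec_fun_cong) auto
qed

lemma dec_pred_not:
  assumes "dec_pred k P"
  shows "dec_pred k (\<lambda>xs. \<not> P xs)"
  using rec_fun_diff[OF rec_fun_const[of k 1] assms[unfolded dec_pred_def]]
  unfolding dec_pred_def by (rule rec_fun_cong) auto

lemma dec_pred_conj:
  assumes "dec_pred k P" "dec_pred k Q"
  shows "dec_pred k (\<lambda>xs. P xs \<and> Q xs)"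
  using rec_fun_mult[OF assms[unfolded dec_pred_def]]
  unfolding dec_pred_def by (rule rec_fun_cong) auto

lemma dec_pred_disj:
  assumes "dec_pred k P" "dec_pred k Q"
  shows "dec_pred k (\<lambda>xs. P xs \<or> Q xs)"
  using dec_pred_not[OF dec_pred_conj[OF dec_pred_not dec_pred_not, OF assms]] by simp

lemma dec_pred_if:
  assumes "dec_pred k P" "dec_pred k Q" "dec_pred k S"
  shows "dec_pred k (\<lambda>xs. if P xs then Q xs else S xs)"
  using dec_pred_disj[OF dec_pred_conj[OF assms(1,2)] dec_pred_conj[OF dec_pred_not[OF assms(1)] assms(3)]]
  by (simp add: if_bool_eq_disj)

lemma dec_pred_eq:
  assumes "rec_fun k f" "rec_fun k g"
  shows "dec_pred k (\<lambda>xs. f xs = g xs)"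
proof -
  have "dec_pred k (\<lambda>xs. \<not> (f xs - g xs) + (g xs - f xs) \<noteq> 0)"
    by (intro dec_pred_not dec_pred_neq_0 rec_fun_add rec_fun_diff assms)
  moreover have "\<not> (x - y) + (y - x) \<noteq> 0 \<longleftrightarrow> x = y" for x y :: nat
    by auto
  ultimately show ?thesis by simp
qed

text \<open>The number of witnesses below the bound is a finite sum, and it is nonzero iff there is
  a witness.\<close>

lemma dec_pred_bex:
  assumes "dec_pred (Suc k) (\<lambda>zs. P (zs ! 0) (drop 1 zs))" "rec_fun k h"
  shows "dec_pred k (\<lambda>xs. \<exists>i<h xs. P i xs)"
proof -
  have "dec_pred k (\<lambda>xs. (\<Sum>i<h xs. of_bool (P i xs)) \<noteq> (0::nat))"
    using assms unfolding dec_pred_def[of "Suc k"] by (intro dec_pred_neq_0 rec_fun_sum)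
  moreover have "(\<Sum>i<m. of_bool (P i xs)) \<noteq> (0::nat) \<longleftrightarrow> (\<exists>i<m. P i xs)" for m xs
    by (subst sum_eq_0_iff) auto
  ultimately show ?thesis by simp
qed

lemmas rec_intros = rec_fun_nth rec_fun_nth_drop rec_fun_nth_drop_drop rec_fun_nth_drop_drop_drop
  rec_fun_const rec_fun_Suc rec_fun_add rec_fun_mult rec_fun_diff rec_fun_power rec_fun_sum
  dec_pred_not dec_pred_conj dec_pred_disj dec_pred_if dec_pred_eq dec_pred_bex

text \<open>The search for a cofactor of \<open>y\<close> can stop at \<open>y\<close>: for
  \<open>x = 0\<close> the cofactor 0 will do, otherwise \<open>i \<le> x * i\<close>.\<close>

lemma dec_pred_dvd:
  assumes "rec_fun k f" "rec_fun k g"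
  shows "dec_pred k (\<lambda>xs. f xs dvd g xs)"
proof -
  have "dec_pred 2 (\<lambda>xs. \<exists>i<Suc (xs ! 1). xs ! 0 * i = xs ! 1)"
    by (intro rec_intros) auto
  moreover have "(\<exists>i<Suc y. x * i = y) \<longleftrightarrow> x dvd y" for x y :: nat
  proof
    assume "x dvd y"
    then obtain i where "y = x * i" ..
    then show "\<exists>i<Suc y. x * i = y"
      by (cases "x = 0") (auto intro: exI[of _ 0] exI[of _ i] simp: less_Suc_eq_le)
  qed auto
  ultimately have "dec_pred 2 (\<lambda>xs. xs ! 0 dvd xs ! 1)" by simp
  then show ?thesis
    using rec_fun_comp2[of "\<lambda>x y. of_bool (x dvd y)"] assms unfolding dec_pred_def by blast
qed

section \<open>Decoding of pairs and lists\<close>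

lemma rec_fun_triangle:
  assumes "rec_fun k f"
  shows "rec_fun k (\<lambda>xs. triangle (f xs))"
proof -
  have "triangle m = (\<Sum>i<m. Suc i)" for m
    by (induction m) (auto simp: triangle_Suc)
  then show ?thesis by (simp del: sum.lessThan_Suc) (intro rec_intros assms, auto)
qed

text \<open>A code bounds both components of its pair, and
  \<open>prod_encode (x, y) = triangle (x + y) + x\<close>. The pair is therefore found by bounded
  search, and a sum weighted by the indicator of success returns the component found.\<close>

lemma rec_fun_prod_decode:
  assumes "rec_fun k f"
  shows "rec_fun k (\<lambda>xs. fst (prod_decode (f xs)))" and "rec_fun k (\<lambda>xs. snd (prod_decode (f xs)))"
proof -
  let ?P = "\<lambda>x y m. triangle (x + y) + x = m"
  let ?fst = "\<lambda>m. \<Sum>x<Suc m. x * of_bool (\<exists>y<Suc m. ?P x y m)"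
  let ?snd = "\<lambda>m. \<Sum>y<Suc m. y * of_bool (\<exists>x<Suc m. ?P x y m)"
  have *: "?fst m = fst (prod_decode m) \<and> ?snd m = snd (prod_decode m)" for m
  proof -
    obtain a b where ab: "prod_decode m = (a, b)" by fastforce
    then have m: "m = prod_encode (a, b)" by (metis prod_decode_inverse)
    have P: "?P x y m \<longleftrightarrow> x = a \<and> y = b" for x y
      using prod_encode_eq[of "(x, y)" "(a, b)"] by (simp add: m prod_encode_def)
    have "a < Suc m" "b < Suc m"
      by (simp_all only: m less_Suc_eq_le le_prod_encode_1 le_prod_encode_2)
    then have "(\<exists>y<Suc m. ?P x y m) \<longleftrightarrow> x = a" "(\<exists>x<Suc m. ?P x y m) \<longleftrightarrow> y = b" for x y
      unfolding P by blast+
    then have "?fst m = (\<Sum>x<Suc m. if x = a then a else 0)"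
      and "?snd m = (\<Sum>y<Suc m. if y = b then b else 0)"
      by (auto intro!: sum.cong simp del: sum.lessThan_Suc)
    then show ?thesis
      using \<open>a < Suc m\<close> \<open>b < Suc m\<close> by (simp add: ab sum.delta del: sum.lessThan_Suc)
  qed
  then have fst: "?fst m = fst (prod_decode m)" and snd: "?snd m = snd (prod_decode m)" for m
    by blast+
  have "rec_fun 1 (\<lambda>xs. ?fst (xs ! 0))"
    by (intro rec_intros rec_fun_triangle dec_pred_bex[unfolded dec_pred_def]
        dec_pred_eq[unfolded dec_pred_def]) auto
  from rec_fun_comp1[OF this[unfolded fst] assms]
  show "rec_fun k (\<lambda>xs. fst (prod_decode (f xs)))" .
  have "rec_fun 1 (\<lambda>xs. ?snd (xs ! 0))"
    by (intro rec_intros rec_fun_triangle dec_pred_bex[unfolded dec_pred_def]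
        dec_pred_eq[unfolded dec_pred_def]) auto
  from rec_fun_comp1[OF this[unfolded snd] assms]
  show "rec_fun k (\<lambda>xs. snd (prod_decode (f xs)))" .
qed

text \<open>A nonempty list is coded as \<open>Suc (prod_encode (head, code of the tail))\<close>,
  so each round passes to the code of the tail.\<close>

definition drop_code :: "nat \<Rightarrow> nat \<Rightarrow> nat" where
  "drop_code c i = rec_nat c (\<lambda>_ d. snd (prod_decode (d - 1))) i"

lemma drop_code: "i \<le> length ls \<Longrightarrow> drop_code (list_encode ls) i = list_encode (drop i ls)"
proof (induction i)
  case (Suc i)
  then have "drop i ls = ls ! i # drop (Suc i) ls" by (simp add: Cons_nth_drop_Suc)
  with Suc show ?case by (simp add: drop_code_def)
qed (simp add: drop_code_def)

text \<open>The code 0 of the empty list is a fixed point of the iteration, since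
  \<open>0 - 1 = 0\<close> and 0 decodes to \<open>(0, 0)\<close>.\<close>

lemma drop_code_ge: "length ls \<le> i \<Longrightarrow> drop_code (list_encode ls) i = 0"
proof (induction rule: dec_induct)
  case (step i)
  have "snd (prod_decode 0) = 0" using prod_encode_inverse[of "(0, 0)"] by (simp add: prod_encode_def)
  with step show ?case by (simp add: drop_code_def)
qed (simp add: drop_code)

lemma rec_fun_drop_code:
  assumes "rec_fun k f" "rec_fun k g"
  shows "rec_fun k (\<lambda>xs. drop_code (f xs) (g xs))"
  unfolding drop_code_def
  by (rule rec_fun_rec_nat[OF assms]) (intro rec_fun_prod_decode rec_intros, simp)

section \<open>Integer-valued recursive functions\<close>

text \<open>Integers occur only as intermediate values; differences of natural numbers represent
  them without any coding.\<close>

definition int_rec :: "nat \<Rightarrow> (nat list \<Rightarrow> int) \<Rightarrow> bool" where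
  "int_rec k f \<longleftrightarrow> (\<exists>g h. rec_fun k g \<and> rec_fun k h \<and> f = (\<lambda>xs. int (g xs) - int (h xs)))"

lemma int_recI:
  assumes "rec_fun k g" "rec_fun k h" "\<And>xs. f xs = int (g xs) - int (h xs)"
  shows "int_rec k f"
  using assms unfolding int_rec_def by blast

lemma int_rec_comp1:
  assumes "int_rec 1 (\<lambda>xs. F (xs ! 0))" "rec_fun k f"
  shows "int_rec k (\<lambda>xs. F (f xs))"
proof -
  obtain g h where "rec_fun 1 g" "rec_fun 1 h" and F: "(\<lambda>xs. F (xs ! 0)) = (\<lambda>xs. int (g xs) - int (h xs))"
    using assms(1) unfolding int_rec_def by blast
  then have "rec_fun k (\<lambda>xs. g [f xs])" "rec_fun k (\<lambda>xs. h [f xs])"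
    using rec_fun_comp[of "[f]" g k] rec_fun_comp[of "[f]" h k] assms(2) by auto
  then show ?thesis
    by (rule int_recI) (use fun_cong[OF F] in \<open>metis nth_Cons_0\<close>)
qed

lemma int_rec_of_nat:
  assumes "rec_fun k f"
  shows "int_rec k (\<lambda>xs. int (f xs))"
  by (rule int_recI[OF assms rec_fun_const[of k 0]]) simp

lemma int_rec_of_bool: "dec_pred k P \<Longrightarrow> int_rec k (\<lambda>xs. int (of_bool (P xs)))"
  unfolding dec_pred_def by (rule int_rec_of_nat)

lemma int_rec_diff:
  assumes "int_rec k f" "int_rec k g"
  shows "int_rec k (\<lambda>xs. f xs - g xs)"
proof -
  obtain f1 f2 g1 g2 where *: "rec_fun k f1" "rec_fun k f2" "rec_fun k g1" "rec_fun k g2"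
      and "f = (\<lambda>xs. int (f1 xs) - int (f2 xs))" "g = (\<lambda>xs. int (g1 xs) - int (g2 xs))"
    using assms unfolding int_rec_def by blast
  then show ?thesis
    by (intro int_recI[of k "\<lambda>xs. f1 xs + g2 xs" "\<lambda>xs. f2 xs + g1 xs"]) (auto intro: rec_intros)
qed

lemma int_rec_const: "int_rec k (\<lambda>_. c)"
  by (rule int_recI[OF rec_fun_const[of k "nat c"] rec_fun_const[of k "nat (- c)"]]) simp

lemma int_rec_add:
  assumes "int_rec k f" "int_rec k g"
  shows "int_rec k (\<lambda>xs. f xs + g xs)"
  using int_rec_diff[OF assms(1) int_rec_diff[OF int_rec_const[of k 0] assms(2)]] by simp

lemma int_rec_mult:
  assumes "int_rec k f" "int_rec k g"
  shows "int_rec k (\<lambda>xs. f xs * g xs)"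
proof -
  obtain f1 f2 g1 g2 where *: "rec_fun k f1" "rec_fun k f2" "rec_fun k g1" "rec_fun k g2"
      and "f = (\<lambda>xs. int (f1 xs) - int (f2 xs))" "g = (\<lambda>xs. int (g1 xs) - int (g2 xs))"
    using assms unfolding int_rec_def by blast
  then show ?thesis
    by (intro int_recI[of k "\<lambda>xs. f1 xs * g1 xs + f2 xs * g2 xs" "\<lambda>xs. f1 xs * g2 xs + f2 xs * g1 xs"])
      (auto intro: rec_intros simp: algebra_simps)
qed

lemma int_rec_sum:
  assumes "int_rec (Suc k) (\<lambda>zs. F (zs ! 0) (drop 1 zs))" "rec_fun k h"
  shows "int_rec k (\<lambda>xs. \<Sum>i<h xs. F i xs)"
proof -
  obtain g1 g2 where *: "rec_fun (Suc k) g1" "rec_fun (Suc k) g2"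
      and F: "(\<lambda>zs. F (zs ! 0) (drop 1 zs)) = (\<lambda>zs. int (g1 zs) - int (g2 zs))"
    using assms(1) unfolding int_rec_def by blast
  have F': "F i xs = int (g1 (i # xs)) - int (g2 (i # xs))" for i xs
    using fun_cong[OF F, of "i # xs"] by simp
  have "rec_fun k (\<lambda>xs. \<Sum>i<h xs. g (i # xs))" if "rec_fun (Suc k) g" for g
  proof (rule rec_fun_sum[OF _ assms(2)])
    show "rec_fun (Suc k) (\<lambda>zs. g (zs ! 0 # drop 1 zs))"
      using that by (rule rec_fun_cong) (metis Cons_nth_drop_Suc One_nat_def drop0 zero_less_Suc)
  qed
  then show ?thesis using *
    by (intro int_recI[of k "\<lambda>xs. \<Sum>i<h xs. g1 (i # xs)" "\<lambda>xs. \<Sum>i<h xs. g2 (i # xs)"])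
      (auto simp: F' sum_subtractf)
qed

lemma rec_fun_nat:
  assumes "int_rec k f"
  shows "rec_fun k (\<lambda>xs. nat (f xs))"
proof -
  obtain g h where *: "rec_fun k g" "rec_fun k h" and f: "f = (\<lambda>xs. int (g xs) - int (h xs))"
    using assms unfolding int_rec_def by blast
  have "rec_fun k (\<lambda>xs. g xs - h xs)" by (intro rec_intros *)
  then show ?thesis by (rule rec_fun_cong) (simp add: f)
qed

lemma rec_fun_nat_abs:
  assumes "int_rec k f"
  shows "rec_fun k (\<lambda>xs. nat \<bar>f xs\<bar>)"
proof -
  have "rec_fun k (\<lambda>xs. nat (f xs) + nat (0 - f xs))"
    by (intro rec_fun_add rec_fun_nat int_rec_diff int_rec_const assms)
  then show ?thesis by (rule rec_fun_cong) auto
qed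

text \<open>For a negative base the sign of the power is decided by the parity of the
  exponent.\<close>

lemma int_rec_power:
  assumes "rec_fun k f"
  shows "int_rec k (\<lambda>xs. c ^ f xs)"
proof (cases "c \<ge> 0")
  case True
  have "int_rec k (\<lambda>xs. int (nat c ^ f xs))" by (intro int_rec_of_nat rec_intros assms)
  then show ?thesis using True by simp
next
  case False
  have "int_rec k (\<lambda>xs. int (nat (- c) ^ f xs) * (2 * int (of_bool (2 dvd f xs)) - 1))"
    by (intro int_rec_mult int_rec_diff int_rec_const int_rec_of_nat rec_intros assms
        dec_pred_dvd[unfolded dec_pred_def])
  also have "(\<lambda>xs. int (nat (- c) ^ f xs) * (2 * int (of_bool (2 dvd f xs)) - 1)) = (\<lambda>xs. c ^ f xs)"
    using False by (auto simp: fun_eq_iff)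
  finally show ?thesis .
qed

lemma dec_pred_int_eq:
  assumes "int_rec k f" "int_rec k g"
  shows "dec_pred k (\<lambda>xs. f xs = g xs)"
proof -
  have "dec_pred k (\<lambda>xs. nat \<bar>f xs - g xs\<bar> = 0)"
    by (intro rec_intros rec_fun_nat_abs int_rec_diff assms)
  then show ?thesis by simp
qed

lemma dec_pred_int_dvd:
  assumes "int_rec k f" "int_rec k g"
  shows "dec_pred k (\<lambda>xs. f xs dvd g xs)"
proof -
  have "dec_pred k (\<lambda>xs. nat \<bar>f xs\<bar> dvd nat \<bar>g xs\<bar>)"
    by (intro dec_pred_dvd rec_fun_nat_abs assms)
  then show ?thesis by simp
qed

section \<open>The affine representation of \<open>BS(1, n)\<close>\<close>

fun gen_exp :: "nat \<Rightarrow> nat \<times> bool \<Rightarrow> int" where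
  "gen_exp g (i, b) = (if i = g then if b then 1 else - 1 else 0)"

definition t_exp :: "nat word \<Rightarrow> int" where
  "t_exp w = sum_list (map (gen_exp 1) w)"

text \<open>The image of 0 under the affine map of the word, the last letter acting first.\<close>

fun a_val :: "int \<Rightarrow> nat word \<Rightarrow> rat" where
  "a_val n [] = 0"
| "a_val n (l # w) = of_int (gen_exp 0 l) + of_int n powi gen_exp 1 l * a_val n w"

lemma t_exp_simps [simp]:
  "t_exp [] = 0" "t_exp (l # w) = gen_exp 1 l + t_exp w" "t_exp (u @ v) = t_exp u + t_exp v"
  by (simp_all add: t_exp_def)

text \<open>This is the composition of affine maps. The scaling factors multiply because
  \<open>n\<close> is invertible in the rationals.\<close>

lemma a_val_append:
  assumes "n \<noteq> 0"
  shows "a_val n (u @ v) = a_val n u + of_int n powi t_exp u * a_val n v"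
  using assms by (induction u) (auto simp: power_int_add algebra_simps)

lemma t_exp_replicate: "t_exp (replicate k l) = int k * gen_exp 1 l"
  by (induction k) (auto simp: algebra_simps)

lemma a_val_replicate: "a_val n (replicate k (0, b)) = of_nat k * (if b then 1 else - 1)"
  by (induction k) (auto simp: algebra_simps)

abbreviation BS :: "int \<Rightarrow> nat word set monoid" where
  "BS n \<equiv> presented_group {..<2} (BS_relations n)"

abbreviation BS_class :: "int \<Rightarrow> nat word \<Rightarrow> nat word set" where
  "BS_class n \<equiv> word_class {..<2} (BS_relations n)"

lemma t_exp_pres_eq:
  assumes "pres_eq {..<2} (BS_relations n) u v"
  shows "t_exp u = t_exp v"
  using assms
  by (induction rule: pres_eq.induct)
    (auto simp: BS_relations_def gen_power_def t_exp_replicate)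

lemma a_val_pres_eq:
  assumes "pres_eq {..<2} (BS_relations n) u v" "n \<noteq> 0"
  shows "a_val n u = a_val n v"
  using assms
proof (induction rule: pres_eq.induct)
  case (cancel u v x b)
  then show ?case by (auto simp: a_val_append power_int_minus)
next
  case (relation u v l r)
  \<comment> \<open>Both sides of the relation are the translation by 1, because
    \<open>1/n * n = 1\<close> and the exponents of \<open>t\<close> cancel.\<close>
  have "a_val n l = a_val n r" "t_exp l = t_exp r"
    using relation
    by (auto simp: BS_relations_def gen_power_def a_val_append a_val_replicate t_exp_replicate
        power_int_minus of_nat_nat)
  then show ?case using relation by (simp add: a_val_append)
qed auto

text \<open>The class of \<open>w\<close> acts on the rationals as the affine map \<open>y \<mapsto> n ^ t_exp w * y + a_val n w\<close>;
  \<open>c_exp\<close> and \<open>c_val\<close> are the two coordinates of this map.\<close>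

definition c_exp :: "nat word set \<Rightarrow> int" where
  "c_exp x = t_exp (SOME w. w \<in> x)"

definition c_val :: "int \<Rightarrow> nat word set \<Rightarrow> rat" where
  "c_val n x = a_val n (SOME w. w \<in> x)"

lemma some_BS_class:
  assumes "w \<in> words {..<2}"
  shows "pres_eq {..<2} (BS_relations n) w (SOME v. v \<in> BS_class n w)"
proof -
  have "w \<in> BS_class n w" using assms by (simp add: word_class_def pres_eq.refl)
  then have "(SOME v. v \<in> BS_class n w) \<in> BS_class n w" by (rule someI)
  then show ?thesis by (simp add: word_class_def)
qed

lemma c_exp_class [simp]: "w \<in> words {..<2} \<Longrightarrow> c_exp (BS_class n w) = t_exp w"
  using t_exp_pres_eq[OF some_BS_class] by (simp add: c_exp_def)

lemma c_val_class [simp]: "w \<in> words {..<2} \<Longrightarrow> n \<noteq> 0 \<Longrightarrow> c_val n (BS_class n w) = a_val n w"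
  using a_val_pres_eq[OF some_BS_class] by (simp add: c_val_def)

lemma carrier_BS: "carrier (BS n) = BS_class n ` words {..<2}"
  and one_BS: "\<one>\<^bsub>BS n\<^esub> = BS_class n []"
  by (simp_all add: presented_group_def)

lemmas mult_BS = mult_word_class[OF BS_relations_words]

section \<open>The group and its generators, for arbitrary \<open>n\<close>\<close>

locale BS_group =
  fixes n :: int and G (structure) and a t :: "nat word set"
  defines "G \<equiv> BS n" and "a \<equiv> BS_class n [(0, True)]" and "t \<equiv> BS_class n [(1, True)]"
begin

sublocale group G
  unfolding G_def by (rule group_presented_group[OF BS_relations_words])

lemma class_closed [simp]: "w \<in> words {..<2} \<Longrightarrow> BS_class n w \<in> carrier G"
  by (simp add: G_def carrier_BS)

lemma class_append:
  "u \<in> words {..<2} \<Longrightarrow> v \<in> words {..<2} \<Longrightarrow> BS_class n (u @ v) = BS_class n u \<otimes> BS_class n v"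
  by (simp add: G_def mult_BS)

lemma gens_closed [simp]: "a \<in> carrier G" "t \<in> carrier G"
  by (simp_all add: a_def t_def)

lemma inv_gen:
  assumes "g < 2"
  shows "inv BS_class n [(g, True)] = BS_class n [(g, False)]"
proof (rule inv_equality)
  have "BS_class n ([(g, False)] @ [(g, True)]) = BS_class n []"
    using assms pres_eq.cancel[of "[]" "{..<2}" "[]" g "BS_relations n" False]
    by (subst word_class_eq_iff) auto
  then show "BS_class n [(g, False)] \<otimes> BS_class n [(g, True)] = \<one>"
    using assms by (subst class_append[symmetric]) (auto simp: G_def one_BS)
qed (use assms in auto)

text \<open>Induction on a word for \<open>x\<close>, splitting off the first letter. It yields
  formulas for \<psi> from the images of \<open>a\<close> and \<open>t\<close>.\<close>

lemma BS_induct [consumes 1, case_names one a inv_a t inv_t]: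
  assumes "x \<in> carrier G" "P \<one>"
    and "\<And>y. y \<in> carrier G \<Longrightarrow> P y \<Longrightarrow> P (a \<otimes> y)" "\<And>y. y \<in> carrier G \<Longrightarrow> P y \<Longrightarrow> P (inv a \<otimes> y)"
    and "\<And>y. y \<in> carrier G \<Longrightarrow> P y \<Longrightarrow> P (t \<otimes> y)" "\<And>y. y \<in> carrier G \<Longrightarrow> P y \<Longrightarrow> P (inv t \<otimes> y)"
  shows "P x"
proof -
  obtain w where w: "w \<in> words {..<2}" "x = BS_class n w"
    using assms(1) by (auto simp: G_def carrier_BS)
  have "P (BS_class n w)" using w(1)
  proof (induction w)
    case Nil
    then show ?case using assms(2) by (simp add: G_def one_BS)
  next
    case (Cons l w)
    obtain i b where l: "l = (i, b)" by (cases l)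
    have i: "i = 0 \<or> i = 1" and w: "w \<in> words {..<2}" using Cons.prems l by auto
    have "BS_class n (l # w) = BS_class n [l] \<otimes> BS_class n w"
      using class_append[of "[l]" w] Cons.prems by simp
    moreover have "BS_class n [l] \<in> {a, inv a, t, inv t}"
      using i inv_gen[of 0] inv_gen[of 1] l by (cases b) (auto simp: a_def t_def)
    moreover have "P (BS_class n w)" "BS_class n w \<in> carrier G" using Cons w by auto
    ultimately show ?case using assms(3-) by auto
  qed
  then show ?thesis using w by simp
qed

lemma c_exp_mult [simp]:
  assumes "x \<in> carrier G" "y \<in> carrier G"
  shows "c_exp (x \<otimes> y) = c_exp x + c_exp y"
  using assms by (auto simp: G_def carrier_BS mult_BS)

lemma c_exp_one [simp]: "c_exp \<one> = 0"
  by (simp add: G_def one_BS)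

lemma c_exp_gens [simp]: "c_exp a = 0" "c_exp t = 1"
  by (simp_all add: a_def t_def)

lemma c_exp_inv [simp]: "x \<in> carrier G \<Longrightarrow> c_exp (inv x) = - c_exp x"
  using c_exp_mult[of "inv x" x] by (simp add: l_inv)

lemma c_exp_nat_pow [simp]: "x \<in> carrier G \<Longrightarrow> c_exp (x [^] (k::nat)) = int k * c_exp x"
  by (induction k) (auto simp: algebra_simps)

lemma c_exp_int_pow [simp]: "x \<in> carrier G \<Longrightarrow> c_exp (x [^] (k::int)) = k * c_exp x"
  by (cases k rule: int_cases2) (auto simp: int_pow_neg int_pow_int)

text \<open>With the inverse cleared, the two sides can be compared coordinate by
  coordinate.\<close>

lemma twisted_conjugated_iff:
  assumes "\<psi> \<in> hom G G" "u \<in> carrier G" "v \<in> carrier G"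
  shows "twisted_conjugated G \<psi> u v \<longleftrightarrow> (\<exists>x\<in>carrier G. \<psi> x \<otimes> v = u \<otimes> x)"
proof -
  have "v = inv (\<psi> x) \<otimes> u \<otimes> x \<longleftrightarrow> \<psi> x \<otimes> v = u \<otimes> x" if "x \<in> carrier G" for x
  proof -
    have "\<psi> x \<in> carrier G" using assms(1) that by (rule hom_in_carrier)
    then show ?thesis using that assms(2,3) inv_solve_left[of v "\<psi> x" "u \<otimes> x"]
      by (auto simp: m_assoc)
  qed
  then show ?thesis unfolding twisted_conjugated_def by blast
qed

text \<open>If \<open>\<psi>\<close> kills \<open>a\<close>, then \<open>x\<psi>\<close> depends only on the exponent \<open>p\<close> of \<open>t\<close> in \<open>x\<close>, so that
  \<open>x = u\<inverse> (t\<psi>)\<^sup>p v\<close> is a solution as soon as its own exponent is \<open>p\<close>.\<close>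

lemma twisted_conjugated_trivial:
  assumes \<psi>: "\<psi> \<in> hom G G" and a: "\<psi> a = \<one>" and uv: "u \<in> carrier G" "v \<in> carrier G"
  shows "twisted_conjugated G \<psi> u v \<longleftrightarrow> c_exp (\<psi> t) - 1 dvd c_exp u - c_exp v"
proof -
  interpret \<psi>: group_hom G G \<psi> by unfold_locales (rule \<psi>)
  have \<psi>_eq: "\<psi> x = \<psi> t [^] c_exp x" if "x \<in> carrier G" for x
    using that
  proof (induction rule: BS_induct)
    case (t y)
    then show ?case using int_pow_mult[of "\<psi> t" 1 "c_exp y"] by simp
  next
    case (inv_t y)
    then show ?case using int_pow_mult[of "\<psi> t" "-1" "c_exp y"] by (simp add: int_pow_neg)
  qed (auto simp: a)
  show ?thesis
  proof
    assume "twisted_conjugated G \<psi> u v"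
    then obtain x where x: "x \<in> carrier G" "\<psi> x \<otimes> v = u \<otimes> x"
      using twisted_conjugated_iff[OF \<psi> uv] by blast
    from arg_cong[OF x(2), of c_exp] have "c_exp u - c_exp v = (c_exp (\<psi> t) - 1) * c_exp x"
      using x(1) uv by (subst (asm) \<psi>_eq) (auto simp: algebra_simps)
    then show "c_exp (\<psi> t) - 1 dvd c_exp u - c_exp v" by simp
  next
    assume "c_exp (\<psi> t) - 1 dvd c_exp u - c_exp v"
    then obtain p where p: "c_exp u - c_exp v = (c_exp (\<psi> t) - 1) * p" ..
    let ?x = "inv u \<otimes> (\<psi> t [^] p \<otimes> v)"
    have x: "?x \<in> carrier G" using uv by simp
    \<comment> \<open>With \<open>q = c_exp (\<psi> t)\<close> the exponent is
      \<open>q * p - (c_exp u - c_exp v) = q * p - (q - 1) * p\<close>.\<close>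
    have "c_exp ?x = p" using uv p by (simp add: algebra_simps)
    then have "\<psi> ?x \<otimes> v = u \<otimes> ?x"
      using \<psi>_eq[OF x] uv by (simp add: m_assoc[symmetric])
    then show "twisted_conjugated G \<psi> u v"
      using twisted_conjugated_iff[OF \<psi> uv] x by blast
  qed
qed

section \<open>Commutation rules and normal forms\<close>

lemma class_gen_power:
  assumes "g < 2"
  shows "BS_class n (gen_power g k) = BS_class n [(g, True)] [^] k"
proof -
  have nat: "BS_class n (replicate m (g, b)) = BS_class n [(g, b)] [^] m" for m b
  proof (induction m)
    case 0
    then show ?case by (simp add: G_def one_BS)
  next
    case (Suc m)
    have "replicate m (g, b) \<in> words {..<2}" using assms by (induction m) auto
    then have "BS_class n (replicate m (g, b) @ [(g, b)]) = BS_class n [(g, b)] [^] Suc m"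
      using Suc assms by (subst class_append) auto
    then show ?case by (simp add: replicate_append_same)
  qed
  show ?thesis
  proof (cases k rule: int_cases2)
    case (nonneg m)
    then show ?thesis using nat[of m True] by (simp add: gen_power_def int_pow_int)
  next
    case (nonpos m)
    have "BS_class n (gen_power g k) = BS_class n [(g, False)] [^] m"
      \<comment> \<open>For \<open>m = 0\<close> the sign flag in \<open>gen_power\<close> is
        \<open>True\<close>, but the word is empty.\<close>
      using nat[of m False] by (cases "m = 0") (simp_all add: nonpos gen_power_def G_def one_BS)
    also have "\<dots> = BS_class n [(g, True)] [^] k"
      using assms by (simp add: nonpos int_pow_neg int_pow_int nat_pow_inv flip: inv_gen[OF assms])
    finally show ?thesis .
  qed
qed

lemma gen_power_words: "g < 2 \<Longrightarrow> gen_power g k \<in> words {..<2}"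
  by (auto simp: gen_power_def words_def)

lemma conj_relation: "a = inv t \<otimes> a [^] n \<otimes> t"
proof -
  let ?r = "gen_power 1 (- 1) @ gen_power 0 n @ gen_power 1 1 :: nat word"
  have "(gen_power 0 1, ?r) \<in> BS_relations n" by (simp add: BS_relations_def)
  then have "pres_eq {..<2} (BS_relations n) (gen_power 0 1) ?r"
    using pres_eq.relation[of "[]" "{..<2}" "[]"] by simp
  then have "BS_class n (gen_power 0 1) = BS_class n ?r"
    by (subst word_class_eq_iff) (auto simp: gen_power_words)
  then show ?thesis
    by (simp add: class_append gen_power_words class_gen_power int_pow_neg m_assoc flip: a_def)
      (simp add: t_def)
qed

lemma t_a: "t \<otimes> a = a [^] n \<otimes> t"
proof -
  have "t \<otimes> (inv t \<otimes> a [^] n \<otimes> t) = a [^] n \<otimes> t" by (simp add: m_assoc[symmetric])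
  then show ?thesis using conj_relation by argo
qed

lemma t_a_pow: "t \<otimes> a [^] k = a [^] (n * k) \<otimes> t"
proof (induction k rule: int_induct[of _ 0])
  case (step1 k)
  have "t \<otimes> a [^] (k + 1) = t \<otimes> a [^] k \<otimes> a" by (simp add: int_pow_mult m_assoc)
  also have "\<dots> = a [^] (n * k) \<otimes> (t \<otimes> a)" by (simp add: step1 m_assoc)
  also have "\<dots> = a [^] (n * (k + 1)) \<otimes> t"
    by (simp add: t_a m_assoc[symmetric] int_pow_mult[symmetric] algebra_simps)
  finally show ?case .
next
  case (step2 k)
  \<comment> \<open>Inserting \<open>a [^] (- n) \<otimes> a [^] n\<close> makes the relation
    \<open>t_a\<close> applicable from right to left.\<close>
  have "t \<otimes> inv a = a [^] (- n) \<otimes> (a [^] n \<otimes> t) \<otimes> inv a"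
    by (simp add: m_assoc[symmetric] int_pow_mult[symmetric])
  also have "\<dots> = a [^] (- n) \<otimes> t"
    unfolding t_a[symmetric] by (simp add: m_assoc)
  finally have inv: "t \<otimes> inv a = a [^] (- n) \<otimes> t" .
  have "t \<otimes> a [^] (k - 1) = t \<otimes> a [^] k \<otimes> inv a"
    using int_pow_mult[of a k "- 1"] by (simp add: m_assoc int_pow_neg)
  also have "\<dots> = a [^] (n * k) \<otimes> (t \<otimes> inv a)" by (simp add: step2 m_assoc)
  also have "\<dots> = a [^] (n * (k - 1)) \<otimes> t"
    by (simp add: inv m_assoc[symmetric] int_pow_mult[symmetric] algebra_simps)
  finally show ?case .
qed simp

lemma t_pow_a_pow: "t [^] (i::nat) \<otimes> a [^] k = a [^] (n ^ i * k) \<otimes> t [^] i"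
proof (induction i arbitrary: k)
  case (Suc i)
  have "t [^] Suc i \<otimes> a [^] k = t [^] i \<otimes> a [^] (n * k) \<otimes> t"
    by (simp add: m_assoc t_a_pow)
  then show ?case by (simp add: Suc m_assoc mult_ac)
qed simp

text \<open>These products are closed under left multiplication by the generators and their
  inverses. A factor \<open>t\<close> cancels against \<open>inv (t [^] i)\<close> or, for
  \<open>i = 0\<close>, moves past the power of \<open>a\<close>.\<close>

lemma normal_form:
  assumes "x \<in> carrier G"
  obtains i j :: nat and k :: int where "x = inv (t [^] i) \<otimes> (a [^] k \<otimes> t [^] j)"
proof -
  have a_pow: "\<exists>(i::nat) (j::nat) (k::int). a [^] e \<otimes> y = inv (t [^] i) \<otimes> (a [^] k \<otimes> t [^] j)"
    if y: "y = inv (t [^] i) \<otimes> (a [^] k \<otimes> t [^] j)" for y and e k :: int and i j :: nat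
  proof -
    \<comment> \<open>A power of \<open>a\<close> crosses \<open>inv (t [^] i)\<close> to the right
      of it at the cost of the factor \<open>n ^ i\<close> in its exponent.\<close>
    have "inv (t [^] i) \<otimes> a [^] (n ^ i * e) = inv (t [^] i) \<otimes> (t [^] i \<otimes> a [^] e \<otimes> inv (t [^] i))"
      by (simp add: t_pow_a_pow m_assoc)
    also have "\<dots> = a [^] e \<otimes> inv (t [^] i)"
      by (simp add: m_assoc[symmetric])
    finally have "a [^] e \<otimes> y = inv (t [^] i) \<otimes> (a [^] (n ^ i * e + k) \<otimes> t [^] j)"
      by (simp add: y int_pow_mult m_assoc[symmetric])
    then show ?thesis by blast
  qed
  from assms have "\<exists>(i::nat) (j::nat) (k::int). x = inv (t [^] i) \<otimes> (a [^] k \<otimes> t [^] j)"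
  proof (induction rule: BS_induct)
    case one
    show ?case by (rule exI[of _ 0], rule exI[of _ 0], rule exI[of _ 0]) simp
  next
    case (a y)
    then show ?case using a_pow[of y _ _ _ 1] by auto
  next
    case (inv_a y)
    then show ?case using a_pow[of y _ _ _ "- 1"] by (auto simp: int_pow_neg)
  next
    case (t y)
    then obtain i j :: nat and k :: int where y: "y = inv (t [^] i) \<otimes> (a [^] k \<otimes> t [^] j)"
      by blast
    show ?case
    proof (cases i)
      case 0
      then have "t \<otimes> y = inv (t [^] (0::nat)) \<otimes> (a [^] (n * k) \<otimes> t [^] Suc j)"
        unfolding y 0 nat_pow_Suc2[OF gens_closed(2)] by (simp add: t_a_pow flip: m_assoc)
      then show ?thesis by blast
    next
      case (Suc i')
      then have "t \<otimes> y = inv (t [^] i') \<otimes> (a [^] k \<otimes> t [^] j)"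
        by (simp add: y m_assoc[symmetric] inv_mult_group)
      then show ?thesis by blast
    qed
  next
    case (inv_t y)
    then obtain i j :: nat and k :: int where "y = inv (t [^] i) \<otimes> (a [^] k \<otimes> t [^] j)"
      by blast
    then have "inv t \<otimes> y = inv (t [^] Suc i) \<otimes> (a [^] k \<otimes> t [^] j)"
      by (simp add: inv_mult_group m_assoc)
    then show ?case by blast
  qed
  then show ?thesis using that by blast
qed

end

section \<open>The case \<open>\<bar>n\<bar> \<ge> 2\<close>: the affine representation is
  faithful\<close>

locale BS_solvable = BS_group +
  assumes n: "\<bar>n\<bar> \<ge> 2"
begin

abbreviation N :: rat where "N \<equiv> of_int n"

lemma n_neq_0 [simp]: "n \<noteq> 0" and n_neq_1 [simp]: "n \<noteq> 1"
  using n by auto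

text \<open>If two powers with different exponents agreed, a positive power of \<open>n\<close>
  would be 1 and \<open>n\<close> would be a unit.\<close>

lemma powi_eq_iff: "N powi p = N powi q \<longleftrightarrow> p = q"
proof
  assume *: "N powi p = N powi q"
  have "p \<le> q" if "N powi p = N powi q" for p q
  proof (rule ccontr)
    assume "\<not> p \<le> q"
    then obtain m where m: "p - q = int (Suc m)" by (metis zless_iff_Suc_zadd add_diff_cancel_left' not_le)
    have "N powi (p - q) = 1" using that by (simp add: power_int_diff)
    then have "of_int (n ^ Suc m) = (1::rat)" unfolding m power_int_of_nat by simp
    then have "n dvd 1" by (metis dvd_triv_left of_int_eq_1_iff power_Suc)
    then show False using n by simp
  qed
  from this[OF *] this[OF *[symmetric]] show "p = q" by simp
qed simp

lemma c_val_mult [simp]: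
  assumes "x \<in> carrier G" "y \<in> carrier G"
  shows "c_val n (x \<otimes> y) = c_val n x + N powi c_exp x * c_val n y"
  using assms by (auto simp: G_def carrier_BS mult_BS a_val_append)

lemma c_val_one [simp]: "c_val n \<one> = 0"
  by (simp add: G_def one_BS)

lemma c_val_gens [simp]: "c_val n a = 1" "c_val n t = 0"
  by (simp_all add: a_def t_def)

lemma c_val_inv [simp]:
  assumes "x \<in> carrier G"
  shows "c_val n (inv x) = - (N powi - c_exp x * c_val n x)"
proof -
  have "c_val n (inv x) + N powi - c_exp x * c_val n x = 0"
    using assms c_val_mult[of "inv x" x] by (simp add: l_inv)
  then show ?thesis by (simp only: add_eq_0_iff2)
qed

lemma c_val_nat_pow: "x \<in> carrier G \<Longrightarrow> c_exp x = 0 \<Longrightarrow> c_val n (x [^] (k::nat)) = of_nat k * c_val n x"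
  by (induction k) (auto simp: algebra_simps)

lemma c_val_int_pow:
  "x \<in> carrier G \<Longrightarrow> c_exp x = 0 \<Longrightarrow> c_val n (x [^] (k::int)) = of_int k * c_val n x"
  by (cases k rule: int_cases2) (auto simp: int_pow_neg int_pow_int c_val_nat_pow)

lemma c_val_t_pow [simp]: "c_val n (t [^] (k::nat)) = 0"
  by (induction k) auto

lemma c_val_normal_form:
  "c_val n (inv (t [^] (i::nat)) \<otimes> (a [^] (k::int) \<otimes> t [^] (j::nat))) = of_int k / N ^ i"
  by (simp add: c_val_int_pow power_int_minus divide_simps)

lemma c_val_cases:
  assumes "x \<in> carrier G"
  obtains i :: nat and k :: int where "c_val n x = of_int k / N ^ i"
  using normal_form[OF assms] c_val_normal_form by metis

text \<open>Together with \<open>c_val_cases\<close> this identifies the image of the coordinates: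
  all integers for the first and, independently, all of \<int>[1/n] for the second.\<close>

lemma exists_element: "\<exists>x\<in>carrier G. c_exp x = p \<and> c_val n x = of_int k / N ^ i"
proof -
  \<comment> \<open>Expanding the fraction by \<open>n ^ m\<close> keeps the exponent
    \<open>p + i + m\<close> of the last factor nonnegative.\<close>
  define m where "m = nat (- p)"
  let ?x = "inv (t [^] (i + m)) \<otimes> (a [^] (k * n ^ m) \<otimes> t [^] nat (p + int (i + m)))"
  have "c_exp ?x = p" by (simp add: m_def)
  moreover have "c_val n ?x = of_int k / N ^ i"
    unfolding c_val_normal_form by (simp add: power_add)
  ultimately show ?thesis by (intro bexI[of _ ?x]) auto
qed

text \<open>In the normal form, vanishing coordinates force \<open>i = j\<close> and
  \<open>k = 0\<close>. Applied to \<open>inv x \<otimes> y\<close>, this shows that the coordinates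
  separate elements.\<close>

lemma eq_one:
  assumes x: "x \<in> carrier G" and "c_exp x = 0" "c_val n x = 0"
  shows "x = \<one>"
proof -
  obtain i j :: nat and k :: int where nf: "x = inv (t [^] i) \<otimes> (a [^] k \<otimes> t [^] j)"
    using normal_form[OF x] .
  then have "i = j" "k = 0" using assms by (simp_all add: c_val_normal_form)
  then show ?thesis by (simp add: nf)
qed

lemma BS_eqI:
  assumes "x \<in> carrier G" "y \<in> carrier G" "c_exp x = c_exp y" "c_val n x = c_val n y"
  shows "x = y"
proof -
  have "inv x \<otimes> y = \<one>"
    using assms by (intro eq_one) (auto simp: power_int_minus)
  then show ?thesis using assms inv_equality inv_inv by (metis inv_closed)
qed

section \<open>Endomorphisms and the reduction to divisibility\<close>

text \<open>Both coordinates of the image of \<open>t \<otimes> a = a [^] n \<otimes> t\<close> are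
  compared. The first gives \<open>(n - 1) * c_exp (\<psi> a) = 0\<close>; the second then gives
  \<open>N powi c_exp (\<psi> t) = N\<close> unless \<open>c_val n (\<psi> a) = 0\<close>.\<close>

lemma hom_gens:
  assumes \<psi>: "\<psi> \<in> hom G G"
  shows "c_exp (\<psi> a) = 0" and "\<psi> a = \<one> \<longleftrightarrow> c_val n (\<psi> a) = 0"
    and "\<psi> a \<noteq> \<one> \<Longrightarrow> c_exp (\<psi> t) = 1"
proof -
  interpret \<psi>: group_hom G G \<psi> by unfold_locales (rule \<psi>)
  have rel: "\<psi> t \<otimes> \<psi> a = \<psi> a [^] n \<otimes> \<psi> t"
    using arg_cong[OF t_a, of \<psi>] by (simp add: \<psi>.hom_int_pow)
  from arg_cong[OF rel, of c_exp] have "(n - 1) * c_exp (\<psi> a) = 0"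
    by (simp add: algebra_simps)
  then show 0: "c_exp (\<psi> a) = 0" by simp
  then show *: "\<psi> a = \<one> \<longleftrightarrow> c_val n (\<psi> a) = 0"
    by (metis c_val_one eq_one gens_closed(1) \<psi>.hom_closed)
  show "c_exp (\<psi> t) = 1" if "\<psi> a \<noteq> \<one>"
  proof -
    from arg_cong[OF rel, of "c_val n"] have "N powi c_exp (\<psi> t) = N powi 1"
      using that * by (simp add: c_val_int_pow 0)
    then show ?thesis unfolding powi_eq_iff .
  qed
qed

text \<open>Here \<open>x\<psi>\<close> has the coordinates \<open>p\<close> and \<open>\<alpha> * \<gamma> + \<beta> * (N powi p - 1) / (N - 1)\<close>, where \<open>p\<close>, \<open>\<gamma>\<close> are
  those of \<open>x\<close>. The factors \<open>N - 1\<close> in \<open>D\<close>, \<open>E\<close> and \<open>F\<close> clear this denominator.\<close>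

lemma twisted_conjugated_nontrivial:
  fixes \<psi> u v
  assumes \<psi>: "\<psi> \<in> hom G G" and a: "\<psi> a \<noteq> \<one>" and uv: "u \<in> carrier G" "v \<in> carrier G"
  defines "D \<equiv> (N - 1) * (c_val n (\<psi> a) - N powi c_exp u)"
    and "E \<equiv> (N - 1) * c_val n u + c_val n (\<psi> t)"
    and "F \<equiv> (N - 1) * c_val n v + c_val n (\<psi> t)"
  shows "twisted_conjugated G \<psi> u v \<longleftrightarrow>
    c_exp u = c_exp v \<and> (\<exists>x\<in>carrier G. D * c_val n x = E - N powi c_exp x * F)"
proof -
  interpret \<psi>: group_hom G G \<psi> by unfold_locales (rule \<psi>)
  note gens = hom_gens[OF \<psi>]
  have N1: "N - 1 \<noteq> 0" by simp
  have \<psi>_eq: "c_exp (\<psi> x) = c_exp x \<and> c_val n (\<psi> x) =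
      c_val n (\<psi> a) * c_val n x + c_val n (\<psi> t) * (N powi c_exp x - 1) / (N - 1)"
    if "x \<in> carrier G" for x
    using that
    by (induction rule: BS_induct)
      (auto simp: gens(1) gens(3)[OF a] power_int_add power_int_diff power_int_minus,
        auto simp: field_simps)
  have "\<psi> x \<otimes> v = u \<otimes> x \<longleftrightarrow>
      c_exp u = c_exp v \<and> D * c_val n x = E - N powi c_exp x * F" if x: "x \<in> carrier G" for x
  proof -
    have "\<psi> x \<otimes> v = u \<otimes> x \<longleftrightarrow> c_exp (\<psi> x \<otimes> v) = c_exp (u \<otimes> x) \<and>
        c_val n (\<psi> x \<otimes> v) = c_val n (u \<otimes> x)"
      using x uv by (metis BS_eqI m_closed \<psi>.hom_closed)
    \<comment> \<open>Since \<psi> preserves the exponent of \<open>t\<close>, the contribution of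
      \<open>x\<close> cancels.\<close>
    also have "c_exp (\<psi> x \<otimes> v) = c_exp (u \<otimes> x) \<longleftrightarrow> c_exp u = c_exp v"
      using x uv \<psi>_eq[OF x] by auto
    also have "c_val n (\<psi> x \<otimes> v) = c_val n (u \<otimes> x) \<longleftrightarrow>
        (N - 1) * c_val n (\<psi> x \<otimes> v) = (N - 1) * c_val n (u \<otimes> x)"
      using N1 by simp
    also have "\<dots> \<longleftrightarrow> D * c_val n x = E - N powi c_exp x * F"
      using x uv \<psi>_eq[OF x] N1 unfolding D_def E_def F_def
      by (auto simp: power_int_add field_simps)
    finally show ?thesis .
  qed
  then show ?thesis unfolding twisted_conjugated_iff[OF \<psi> uv] by blast
qed

text \<open>The exponents come from \<open>c_exp x = \<alpha> - \<beta>\<close> and \<open>c_val n x = k / N ^ j\<close>.\<close>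

lemma solvable_iff_dvd:
  fixes D E F :: int
  assumes "of_int D = N ^ m * D'" "of_int E = N ^ m * E'" "of_int F = N ^ m * F'"
  shows "(\<exists>x\<in>carrier G. D' * c_val n x = E' - N powi c_exp x * F') \<longleftrightarrow>
    (\<exists>j \<alpha> \<beta>. D dvd n ^ j * (n ^ \<beta> * E - n ^ \<alpha> * F))"
proof -
  have "D' * c_val n x = E' - N powi c_exp x * F' \<longleftrightarrow>
      of_int D * c_val n x = of_int E - N powi c_exp x * of_int F" for x
  proof -
    have "D' * c_val n x = E' - N powi c_exp x * F' \<longleftrightarrow>
        N ^ m * (D' * c_val n x) = N ^ m * (E' - N powi c_exp x * F')" by simp
    then show ?thesis by (simp add: assms algebra_simps)
  qed
  moreover have "(\<exists>x\<in>carrier G. of_int D * c_val n x = of_int E - N powi c_exp x * of_int F) \<longleftrightarrow>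
    (\<exists>j \<alpha> \<beta>. D dvd n ^ j * (n ^ \<beta> * E - n ^ \<alpha> * F))"
  proof safe
    fix x assume x: "x \<in> carrier G"
      and eq: "of_int D * c_val n x = of_int E - N powi c_exp x * of_int F"
    obtain i :: nat and k :: int where c: "c_val n x = of_int k / N ^ i"
      using c_val_cases[OF x] .
    define \<alpha> \<beta> where "\<alpha> = nat (c_exp x)" and "\<beta> = nat (- c_exp x)"
    have "N powi c_exp x = N ^ \<alpha> / N ^ \<beta>"
      by (auto simp: \<alpha>_def \<beta>_def power_int_def divide_simps)
    with eq have "of_int D * of_int k * N ^ \<beta> = N ^ i * (N ^ \<beta> * of_int E - N ^ \<alpha> * of_int F)"
      by (simp add: c field_simps)
    then have "of_int (D * (k * n ^ \<beta>)) = (of_int (n ^ i * (n ^ \<beta> * E - n ^ \<alpha> * F)) :: rat)"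
      by simp
    then have "n ^ i * (n ^ \<beta> * E - n ^ \<alpha> * F) = D * (k * n ^ \<beta>)"
      by (simp only: of_int_eq_iff)
    then show "\<exists>j \<alpha> \<beta>. D dvd n ^ j * (n ^ \<beta> * E - n ^ \<alpha> * F)"
      by (metis dvd_triv_left)
  next
    fix j \<alpha> \<beta> :: nat assume "D dvd n ^ j * (n ^ \<beta> * E - n ^ \<alpha> * F)"
    then obtain k where "n ^ j * (n ^ \<beta> * E - n ^ \<alpha> * F) = D * k" ..
    then have eq: "N ^ j * (N ^ \<beta> * of_int E - N ^ \<alpha> * of_int F) = of_int D * of_int k"
      by (metis of_int_diff of_int_mult of_int_power)
    \<comment> \<open>Division of \<open>eq\<close> by \<open>N ^ (j + \<beta>)\<close> gives the
      required equation for this element.\<close>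
    obtain x where x: "x \<in> carrier G" "c_exp x = int \<alpha> - int \<beta>" "c_val n x = of_int k / N ^ (j + \<beta>)"
      using exists_element by blast
    have "of_int D * c_val n x = of_int E - N powi c_exp x * of_int F"
      using eq by (simp add: x power_int_diff power_add field_simps)
    then show "\<exists>x\<in>carrier G. of_int D * c_val n x = of_int E - N powi c_exp x * of_int F"
      using x(1) by blast
  qed
  ultimately show ?thesis by simp
qed

text \<open>If \<open>D \<noteq> 0\<close>, the residues of the powers of \<open>n\<close> modulo \<open>D\<close> are exhausted by exponents below
  \<open>\<bar>D\<bar>\<close>; if \<open>D = 0\<close>, then \<open>2 ^ d \<le> \<bar>n\<bar> ^ d\<close> bounds the exponent in \<open>E = n ^ d * F\<close> or \<open>F = n ^ d * E\<close>.\<close>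

lemma bounded_dvd:
  fixes D E F :: int
  defines "B \<equiv> Suc (nat (\<bar>D\<bar> + \<bar>E\<bar> + \<bar>F\<bar>))"
  shows "(\<exists>j \<alpha> \<beta>. D dvd n ^ j * (n ^ \<beta> * E - n ^ \<alpha> * F)) \<longleftrightarrow>
    (\<exists>j<B. \<exists>\<alpha><B. \<exists>\<beta><B. D dvd n ^ j * (n ^ \<beta> * E - n ^ \<alpha> * F))" (is "?L \<longleftrightarrow> ?R")
proof
  assume ?L
  then obtain j \<alpha> \<beta> where dvd: "D dvd n ^ j * (n ^ \<beta> * E - n ^ \<alpha> * F)" by blast
  show ?R
  proof (cases "D = 0")
    case True
    with dvd have eq: "n ^ \<beta> * E = n ^ \<alpha> * F" by simp
    have small: "m < B" if "n ^ m dvd x" "x \<noteq> 0" "x = E \<or> x = F" for m x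
    proof -
      have "int m < 2 ^ m" by simp
      also have "\<dots> \<le> \<bar>n\<bar> ^ m" using n by (intro power_mono) auto
      also have "\<dots> \<le> \<bar>x\<bar>" using dvd_imp_le_int[OF that(2,1)] by (simp add: power_abs)
      finally show ?thesis using that(3) by (auto simp: B_def)
    qed
    consider "E = 0" | "F = 0" | "E \<noteq> 0" "F \<noteq> 0" "\<alpha> \<le> \<beta>" | "E \<noteq> 0" "F \<noteq> 0" "\<beta> \<le> \<alpha>"
      by linarith
    then show ?thesis
    proof cases
      case 3
      then obtain d where d: "\<beta> = \<alpha> + d" by (auto simp: le_iff_add)
      with eq have "n ^ d * E = F" by (simp add: power_add)
      moreover from this have "d < B" using small[of d F] 3 by auto
      ultimately have "D dvd n ^ 0 * (n ^ d * E - n ^ 0 * F)" "0 < B" "d < B"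
        by (simp_all add: B_def)
      then show ?thesis by blast
    next
      case 4
      then obtain d where d: "\<alpha> = \<beta> + d" by (auto simp: le_iff_add)
      with eq have "E = n ^ d * F" by (simp add: power_add)
      moreover from this have "d < B" using small[of d E] 4 by auto
      ultimately have "D dvd n ^ 0 * (n ^ 0 * E - n ^ d * F)" "0 < B" "d < B"
        by (simp_all add: B_def)
      then show ?thesis by blast
    \<comment> \<open>If one of \<open>E\<close> and \<open>F\<close> is 0, so is the other, and all
      exponents may be 0.\<close>
    qed (use eq in \<open>auto simp: B_def intro!: exI[of _ 0]\<close>)
  next
    case False
    have red: "\<exists>m'<B. n ^ m mod D = n ^ m' mod D" for m
    proof -
      \<comment> \<open>The residues up to the least exponent are distinct: if
        \<open>x < y \<le> k\<close> had the same residue, \<open>k - y + x\<close> would be a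
        smaller exponent with the residue of \<open>k\<close>.\<close>
      define k where "k = (LEAST k. n ^ k mod D = n ^ m mod D)"
      have k: "n ^ k mod D = n ^ m mod D" unfolding k_def by (rule LeastI) rule
      have least: "k \<le> i" if "n ^ i mod D = n ^ m mod D" for i
        unfolding k_def using that by (rule Least_le)
      have no: False if "x < y" "y \<le> k" "n ^ x mod D = n ^ y mod D" for x y
      proof -
        have "n ^ (k - y + x) mod D = n ^ (k - y + y) mod D"
          unfolding power_add using that(3) by (metis mod_mult_right_eq)
        then have "n ^ (k - y + x) mod D = n ^ m mod D" using that(2) k by simp
        from least[OF this] that show False by simp
      qed
      have "inj_on (\<lambda>i. n ^ i mod D) {..k}"
        unfolding inj_on_def by (metis no linorder_neqE_nat atMost_iff)
      then have "Suc k = card ((\<lambda>i. n ^ i mod D) ` {..k})" by (simp add: card_image)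
      \<comment> \<open>\<open>mod\<close> takes the sign of the divisor; either interval has
        \<open>\<bar>D\<bar>\<close> elements.\<close>
      also have "\<dots> \<le> card (if D > 0 then {0..<D} else {D<..0})"
        using False pos_mod_bound neg_mod_bound by (intro card_mono) auto
      also have "\<dots> < B" by (auto simp: B_def)
      finally show ?thesis using k by (intro exI[of _ k]) auto
    qed
    obtain j' \<alpha>' \<beta>' where *: "j' < B" "n ^ j mod D = n ^ j' mod D" "\<alpha>' < B" "n ^ \<alpha> mod D = n ^ \<alpha>' mod D"
      "\<beta>' < B" "n ^ \<beta> mod D = n ^ \<beta>' mod D"
      using red by meson
    have "(n ^ j * (n ^ \<beta> * E - n ^ \<alpha> * F)) mod D = (n ^ j' * (n ^ \<beta>' * E - n ^ \<alpha>' * F)) mod D"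
      using * by (intro mod_mult_cong mod_diff_cong) auto
    then have "D dvd n ^ j' * (n ^ \<beta>' * E - n ^ \<alpha>' * F)" using dvd by (simp add: dvd_eq_mod_eq_0)
    then show ?thesis using * by blast
  qed
qed blast

end

section \<open>The decision procedure on codes\<close>

text \<open>The test against 0 asks whether position \<open>i\<close> exists. The letter there has
  the code \<open>2 * g\<close> for the generator \<open>g\<close> and \<open>2 * g + 1\<close> for
  its inverse.\<close>

definition code_exp :: "nat \<Rightarrow> nat \<Rightarrow> nat \<Rightarrow> int" where
  "code_exp g c i =
    int (of_bool (drop_code c i \<noteq> 0 \<and> fst (prod_decode (drop_code c i - 1)) = 2 * g)) -
    int (of_bool (drop_code c i \<noteq> 0 \<and> fst (prod_decode (drop_code c i - 1)) = 2 * g + 1))"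

lemma code_exp: "i < length w \<Longrightarrow> code_exp g (word_code w) i = gen_exp g (w ! i)"
proof -
  assume i: "i < length w"
  obtain j b where w: "w ! i = (j, b)" by fastforce
  have "drop i (map letter_code w) = letter_code (w ! i) # drop (Suc i) (map letter_code w)"
    using i by (simp add: drop_map flip: Cons_nth_drop_Suc)
  then show ?thesis
    using i unfolding code_exp_def word_code_def
    by (auto simp: drop_code w letter_code_def)
qed

lemma code_exp_ge: "length w \<le> i \<Longrightarrow> code_exp g (word_code w) i = 0"
  by (simp add: code_exp_def word_code_def drop_code_ge)

text \<open>Sums over the positions of a word can thus run up to its code, without computing its
  length.\<close>

lemma length_le_word_code: "length w \<le> word_code w"
proof (induction w)
  case (Cons l w)
  have "list_encode (map letter_code w) \<le> prod_encode (letter_code l, list_encode (map letter_code w))"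
    by (rule le_prod_encode_2)
  with Cons show ?case by (simp add: word_code_def)
qed simp

lemma sum_word_code:
  assumes "\<And>i. length w \<le> i \<Longrightarrow> f i = (0::'a::comm_monoid_add)"
  shows "(\<Sum>i<word_code w. f i) = (\<Sum>i<length w. f i)"
  using length_le_word_code[of w] assms by (intro sum.mono_neutral_right) auto

definition code_t :: "nat \<Rightarrow> int" where
  "code_t c = (\<Sum>i<c. code_exp 1 c i)"

text \<open>The scaling by \<open>n ^ c\<close> makes all exponents nonnegative, so that \<open>nat\<close> does not truncate.\<close>

definition code_a :: "int \<Rightarrow> nat \<Rightarrow> int" where
  "code_a n c = (\<Sum>i<c. code_exp 0 c i * n ^ nat (int c + (\<Sum>k<i. code_exp 1 c k)))"

lemma code_t: "code_t (word_code w) = t_exp w"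
proof -
  have "code_t (word_code w) = (\<Sum>i<length w. gen_exp 1 (w ! i))"
    unfolding code_t_def by (subst sum_word_code) (auto simp: code_exp_ge code_exp)
  then show ?thesis by (simp add: t_exp_def sum_list_sum_nth atLeast0LessThan)
qed

lemma abs_t_exp_le: "\<bar>t_exp w\<bar> \<le> int (length w)"
  by (induction w) auto

text \<open>Each letter is scaled by \<open>n\<close> to the exponent sum of the letters before it.
  Removing the first letter changes \<open>m\<close> by at most 1, just as the bound on the length
  allows.\<close>

lemma a_val_eq_sum:
  assumes "n \<noteq> 0" "int (length w) \<le> m"
  shows "of_int (\<Sum>i<length w. gen_exp 0 (w ! i) * n ^ nat (m + (\<Sum>k<i. gen_exp 1 (w ! k)))) =
    of_int n powi m * a_val n w"
  using assms(2)
proof (induction w arbitrary: m)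
  case (Cons l w)
  have l: "\<bar>gen_exp 1 l\<bar> \<le> 1" by (cases l) auto
  have "of_int (n ^ nat m) = (of_int n powi m :: rat)"
    using Cons.prems by (simp add: power_int_def)
  moreover have "of_int (\<Sum>i<length w. gen_exp 0 (w ! i) *
      n ^ nat (m + gen_exp 1 l + (\<Sum>k<i. gen_exp 1 (w ! k)))) = of_int n powi (m + gen_exp 1 l) * a_val n w"
    using Cons.prems l by (intro Cons.IH) auto
  ultimately show ?case
    using assms(1)
    by (simp add: sum.lessThan_Suc_shift power_int_add algebra_simps del: sum.lessThan_Suc)
qed simp

lemma code_a:
  assumes "n \<noteq> 0"
  shows "of_int (code_a n (word_code w)) = of_int n ^ word_code w * a_val n w"
proof -
  have "code_a n (word_code w) = (\<Sum>i<length w. code_exp 0 (word_code w) i *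
      n ^ nat (int (word_code w) + (\<Sum>k<i. code_exp 1 (word_code w) k)))"
    unfolding code_a_def by (rule sum_word_code) (simp add: code_exp_ge)
  also have "\<dots> = (\<Sum>i<length w. gen_exp 0 (w ! i) *
      n ^ nat (int (word_code w) + (\<Sum>k<i. gen_exp 1 (w ! k))))"
    by (intro sum.cong) (auto simp: code_exp)
  finally show ?thesis
    using a_val_eq_sum[OF assms, of w "int (word_code w)"] length_le_word_code[of w] by simp
qed

section \<open>Recursiveness of the procedure\<close>

lemma int_rec_code_exp:
  assumes "rec_fun k f" "rec_fun k h"
  shows "int_rec k (\<lambda>xs. code_exp g (f xs) (h xs))"
  unfolding code_exp_def
  by (intro int_rec_diff int_rec_of_bool rec_intros rec_fun_prod_decode rec_fun_drop_code assms)

lemma int_rec_code_t: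
  assumes "rec_fun k f"
  shows "int_rec k (\<lambda>xs. code_t (f xs))"
proof -
  have "int_rec 1 (\<lambda>xs. code_t (xs ! 0))"
    unfolding code_t_def by (intro int_rec_sum int_rec_code_exp rec_intros) auto
  then show ?thesis using assms by (rule int_rec_comp1)
qed

lemma int_rec_code_a:
  assumes "rec_fun k f"
  shows "int_rec k (\<lambda>xs. code_a n (f xs))"
proof -
  have "int_rec 1 (\<lambda>xs. code_a n (xs ! 0))"
    unfolding code_a_def
    by (intro int_rec_sum int_rec_mult int_rec_power rec_fun_nat int_rec_add int_rec_of_nat
        int_rec_code_exp rec_intros) auto
  then show ?thesis using assms by (rule int_rec_comp1)
qed

text \<open>\<open>code_D n A T U V\<close>, \<open>code_E n A T U V\<close> and \<open>code_E n A T V U\<close> are the numbers \<open>D\<close>, \<open>E\<close> and \<open>F\<close>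
  of \<open>twisted_conjugated_nontrivial\<close>, scaled by \<open>n ^ (A + T + U + V)\<close> to become integers. The code of
  a word bounds its length, and thus the exponents of \<open>n\<close> in its denominators.\<close>

definition code_D :: "int \<Rightarrow> nat \<Rightarrow> nat \<Rightarrow> nat \<Rightarrow> nat \<Rightarrow> int" where
  "code_D n A T U V =
    (n - 1) * (n ^ (T + U + V) * code_a n A - n ^ nat (int (A + T + U + V) + code_t U))"

definition code_E :: "int \<Rightarrow> nat \<Rightarrow> nat \<Rightarrow> nat \<Rightarrow> nat \<Rightarrow> int" where
  "code_E n A T U V =
    (n - 1) * (n ^ (A + T + V) * code_a n U) + n ^ (A + U + V) * code_a n T"

text \<open>The bound \<open>B\<close> of \<open>bounded_dvd\<close> for the scaled
  coefficients.\<close>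

definition code_bound :: "int \<Rightarrow> nat \<Rightarrow> nat \<Rightarrow> nat \<Rightarrow> nat \<Rightarrow> nat" where
  "code_bound n A T U V =
    Suc (nat (\<bar>code_D n A T U V\<bar> + \<bar>code_E n A T U V\<bar> + \<bar>code_E n A T V U\<bar>))"

definition code_trivial :: "nat \<Rightarrow> nat \<Rightarrow> nat \<Rightarrow> bool" where
  "code_trivial T U V \<longleftrightarrow> code_t T - 1 dvd code_t U - code_t V"

definition code_nontrivial :: "int \<Rightarrow> nat \<Rightarrow> nat \<Rightarrow> nat \<Rightarrow> nat \<Rightarrow> bool" where
  "code_nontrivial n A T U V \<longleftrightarrow> code_t U = code_t V \<and>
    (\<exists>j<code_bound n A T U V. \<exists>\<alpha><code_bound n A T U V. \<exists>\<beta><code_bound n A T U V.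
      code_D n A T U V dvd n ^ j * (n ^ \<beta> * code_E n A T U V - n ^ \<alpha> * code_E n A T V U))"

context
  fixes k :: nat and A T U V :: "nat list \<Rightarrow> nat"
  assumes rec: "rec_fun k A" "rec_fun k T" "rec_fun k U" "rec_fun k V"
begin

lemma int_rec_code_D: "int_rec k (\<lambda>xs. code_D n (A xs) (T xs) (U xs) (V xs))"
  unfolding code_D_def
  by (intro int_rec_mult int_rec_add int_rec_diff int_rec_const int_rec_power rec_fun_add rec_fun_nat
      int_rec_of_nat int_rec_code_t int_rec_code_a rec)

lemma int_rec_code_E: "int_rec k (\<lambda>xs. code_E n (A xs) (T xs) (U xs) (V xs))"
  unfolding code_E_def
  by (intro int_rec_mult int_rec_add int_rec_diff int_rec_const int_rec_power rec_fun_add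
      int_rec_code_a rec)

end

lemma rec_fun_code_bound:
  assumes "rec_fun k A" "rec_fun k T" "rec_fun k U" "rec_fun k V"
  shows "rec_fun k (\<lambda>xs. code_bound n (A xs) (T xs) (U xs) (V xs))"
proof -
  have "rec_fun k (\<lambda>xs. Suc (nat \<bar>code_D n (A xs) (T xs) (U xs) (V xs)\<bar> +
      nat \<bar>code_E n (A xs) (T xs) (U xs) (V xs)\<bar> + nat \<bar>code_E n (A xs) (T xs) (V xs) (U xs)\<bar>))"
    by (intro rec_fun_Suc rec_fun_add rec_fun_nat_abs int_rec_code_D int_rec_code_E assms)
  then show ?thesis by (simp add: code_bound_def nat_add_distrib)
qed

lemma dec_pred_code_trivial: "dec_pred 4 (\<lambda>xs. code_trivial (xs ! 1) (xs ! 2) (xs ! 3))"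
  unfolding code_trivial_def
  by (intro dec_pred_int_dvd int_rec_diff int_rec_code_t int_rec_const rec_intros) auto

lemma dec_pred_code_nontrivial:
  "dec_pred 4 (\<lambda>xs. code_nontrivial n (xs ! 0) (xs ! 1) (xs ! 2) (xs ! 3))"
  unfolding code_nontrivial_def
  by (intro dec_pred_int_dvd dec_pred_int_eq int_rec_diff int_rec_mult int_rec_power int_rec_code_t
      int_rec_code_D int_rec_code_E rec_fun_code_bound rec_intros) auto

section \<open>Correctness of the procedure\<close>

lemma (in BS_solvable) twisted_conjugated_code:
  assumes \<psi>: "\<psi> \<in> hom G G" and w: "wa \<in> words {..<2}" "wt \<in> words {..<2}"
    and uv: "u \<in> words {..<2}" "v \<in> words {..<2}"
    and gens: "\<psi> a = BS_class n wa" "\<psi> t = BS_class n wt"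
  shows "twisted_conjugated G \<psi> (BS_class n u) (BS_class n v) \<longleftrightarrow>
    (if code_a n (word_code wa) = 0
     then code_trivial (word_code wt) (word_code u) (word_code v)
     else code_nontrivial n (word_code wa) (word_code wt) (word_code u) (word_code v))"
proof -
  let ?A = "word_code wa" and ?T = "word_code wt" and ?U = "word_code u" and ?V = "word_code v"
  have val_eq: "of_int (code_a n (word_code w)) = N ^ word_code w * a_val n w" for w
    by (rule code_a) simp
  have "of_int (code_a n ?A) = (0::rat) \<longleftrightarrow> a_val n wa = 0"
    unfolding val_eq by simp
  then have "code_a n ?A = 0 \<longleftrightarrow> \<psi> a = \<one>"
    using hom_gens(2)[OF \<psi>] w(1) by (simp add: gens)
  moreover have "twisted_conjugated G \<psi> (BS_class n u) (BS_class n v) \<longleftrightarrow> code_trivial ?T ?U ?V"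
    if "\<psi> a = \<one>"
    using twisted_conjugated_trivial[OF \<psi> that] w uv
    by (simp add: gens code_trivial_def code_t)
  moreover have "twisted_conjugated G \<psi> (BS_class n u) (BS_class n v) \<longleftrightarrow>
    code_nontrivial n ?A ?T ?U ?V" if a: "\<psi> a \<noteq> \<one>"
  proof -
    let ?m = "?A + ?T + ?U + ?V"
    let ?D = "(N - 1) * (a_val n wa - N powi t_exp u)"
      and ?E = "\<lambda>u. (N - 1) * a_val n u + a_val n wt"
    \<comment> \<open>This ensures that \<open>nat\<close> does not truncate the exponent in
      \<open>code_D\<close>.\<close>
    have "0 \<le> int ?m + t_exp u"
      using abs_t_exp_le[of u] length_le_word_code[of u] by linarith
    then have "N ^ nat (int ?m + t_exp u) = N ^ ?m * N powi t_exp u"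
      by (metis n_neq_0 of_int_eq_0_iff power_int_add power_int_of_nat nat_0_le)
    then have D: "of_int (code_D n ?A ?T ?U ?V) = N ^ ?m * ?D"
      by (simp add: code_D_def val_eq code_t) (simp add: power_add algebra_simps)
    have E: "of_int (code_E n ?A ?T ?U ?V) = N ^ ?m * ?E u"
      and F: "of_int (code_E n ?A ?T ?V ?U) = N ^ ?m * ?E v"
      by (simp_all add: code_E_def val_eq) (simp_all add: power_add algebra_simps)
    show ?thesis
      using twisted_conjugated_nontrivial[OF \<psi> a] w uv
      unfolding solvable_iff_dvd[OF D E F, symmetric] bounded_dvd[symmetric]
        code_nontrivial_def code_bound_def
      by (simp add: gens code_t)
  qed
  ultimately show ?thesis by simp
qed

text \<open>For \<open>n = 0\<close> the relation reads \<open>a = 1\<close>, so every endomorphism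
  satisfies the hypothesis of \<open>twisted_conjugated_trivial\<close>.\<close>

lemma twisted_conjugated_code_zero:
  assumes \<psi>: "\<psi> \<in> hom (BS 0) (BS 0)" and w: "wt \<in> words {..<2}"
    and uv: "u \<in> words {..<2}" "v \<in> words {..<2}"
    and gens: "\<psi> (BS_class 0 [(1, True)]) = BS_class 0 wt"
  shows "twisted_conjugated (BS 0) \<psi> (BS_class 0 u) (BS_class 0 v) \<longleftrightarrow>
    code_trivial (word_code wt) (word_code u) (word_code v)"
proof -
  interpret BS_group 0 "BS 0" "BS_class 0 [(0, True)]" "BS_class 0 [(1, True)]"
    by unfold_locales
  interpret \<psi>: group_hom "BS 0" "BS 0" \<psi> by unfold_locales (rule \<psi>)
  have "BS_class 0 [(0, True)] = \<one>\<^bsub>BS 0\<^esub>"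
    using conj_relation by simp
  then have "\<psi> (BS_class 0 [(0, True)]) = \<one>\<^bsub>BS 0\<^esub>" by simp
  from twisted_conjugated_trivial[OF \<psi> this, unfolded gens] w uv show ?thesis
    by (simp add: code_trivial_def code_t)
qed

theorem theorem3p2:
  fixes n :: int
  assumes "n \<noteq> 1" and "n \<noteq> -1"
  shows "endo_twisted_conjugacy_solvable 2 (BS_relations n)"
proof -
  \<comment> \<open>The entries of \<open>xs\<close> are the codes of the words for
    \<open>a\<psi>\<close>, \<open>t\<psi>\<close>, \<open>u\<close> and \<open>v\<close>;
    \<open>n\<close> is a fixed parameter of the procedure.\<close>
  define P where "P xs = (if n = 0 \<or> code_a n (xs ! 0) = 0 then code_trivial (xs ! 1) (xs ! 2) (xs ! 3)
     else code_nontrivial n (xs ! 0) (xs ! 1) (xs ! 2) (xs ! 3))" for xs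
  have "dec_pred 4 P"
    unfolding P_def
    by (intro dec_pred_if dec_pred_disj dec_pred_code_trivial dec_pred_code_nontrivial
        dec_pred_int_eq int_rec_code_a int_rec_const rec_fun_nth) auto
  then obtain f where f: "\<And>xs. length xs = 4 \<Longrightarrow> computes f xs (of_bool (P xs))"
    unfolding dec_pred_def rec_fun_def by blast
  have "computes f (map word_code (ws @ [u, v]))
      (if twisted_conjugated (BS n) \<psi> (BS_class n u) (BS_class n v) then 1 else 0)"
    if \<psi>: "\<psi> \<in> hom (BS n) (BS n)" and ws: "length ws = 2" "set ws \<subseteq> words {..<2}"
      and uv: "u \<in> words {..<2}" "v \<in> words {..<2}"
      and gens: "\<forall>i<2. \<psi> (BS_class n [(i, True)]) = BS_class n (ws ! i)" for \<psi> ws u v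
  proof -
    obtain wa wt where ws_eq: "ws = [wa, wt]"
      using ws(1) by (auto simp: length_Suc_conv numeral_2_eq_2)
    have w: "wa \<in> words {..<2}" "wt \<in> words {..<2}" using ws(2) by (auto simp: ws_eq)
    have gens': "\<psi> (BS_class n [(0, True)]) = BS_class n wa" "\<psi> (BS_class n [(1, True)]) = BS_class n wt"
      using gens[rule_format, of 0] gens[rule_format, of 1] by (simp_all add: ws_eq)
    have "P (map word_code [wa, wt, u, v]) \<longleftrightarrow>
        twisted_conjugated (BS n) \<psi> (BS_class n u) (BS_class n v)"
    proof (cases "n = 0")
      case True
      then show ?thesis
        using twisted_conjugated_code_zero[of \<psi> wt u v] \<psi> w uv gens' by (simp add: P_def)
    next
      case False
      interpret BS_solvable n "BS n" "BS_class n [(0, True)]" "BS_class n [(1, True)]"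
        by unfold_locales (use assms False in auto)
      show ?thesis
        using twisted_conjugated_code[OF \<psi> w uv gens'] False by (simp add: P_def)
    qed
    then show ?thesis
      using f[of "map word_code [wa, wt, u, v]"] by (simp add: ws_eq of_bool_def)
  qed
  then show ?thesis
    unfolding endo_twisted_conjugacy_solvable_def Let_def by blast
qed

end
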